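(* Let $\alpha>-1$, $t\ge0$, and let $x_{1,n}<x_{2,n}<\cdots<x_{n,n}$ denote the $n$ zeros of the orthogonal polynomial $P_n(x;t,\alpha)$ with respect to the singularly perturbed Laguerre weight. Then: (i) the zeros are real, distinct and, for $n\ge2$, $$0<x_{1,n}<x_{1,n-1}<x_{2,n}<\cdots<x_{n-1,n}<x_{n-1,n-1}<x_{n,n};$$ (ii) the zeros strictly increase with $\alpha$ and strictly increase with $t$ (for any fixed zero $x_{j,n}$, $j=1,2,\dots,n$); (iii) for $n\ge2$, the zeros satisfy $$a_n<x_{1,n}<\alpha_{n-1}<x_{n,n}<b_n,$$ where $$a_n=\min_{1\le k\le n-1}\left\{\tfrac12(\alpha_k+\alpha_{k-1})-\tfrac12\sqrt{(\alpha_k-\alpha_{k-1})^2+4c_n\beta_k}\right\},$$ $$b_n=\max_{1\le k\le n-1}\left\{\tfrac12(\alpha_k+\alpha_{k-1})+\tfrac12\sqrt{(\alpha_k-\alpha_{k-1})^2+4c_n\beta_k}\right\},$$ with $c_n=4\cos^2\left(\frac{\pi}{n+1}\right)+\varepsilon$, $\varepsilon\ge0$; (iv) for $n\ge2$, the zeros satisfy $$0<x_{1,n}<\alpha_{n-1}+\frac{d_n\beta_{n-1}}{e_n}<x_{n,n},$$ where $$d_n=\frac{P_n(0;t,\alpha)}{P_{n-1}(0;t,\alpha)}+\frac{P_{n-1}(0;t,\alpha+1)}{P_{n-2}(0;t,\alpha+1)},\qquad e_n=\frac{P_{n-1}(0;t,\alpha)}{P_{n-2}(0;t,\alpha)}\cdot\frac{P_{n-1}(0;t,\alpha+1)}{P_{n-2}(0;t,\alpha+1)}.$$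 In (iii) and (iv), $\alpha_n=\alpha_n(t,\alpha)$ and $\beta_n=\beta_n(t,\alpha)$ are the recurrence coefficients.
   Context: For $\alpha>-1$, $t\ge0$, the singularly perturbed Laguerre weight is $w(x;t,\alpha)=x^\alpha e^{-x-t/x}$ on $(0,\infty)$. $P_n(x;t,\alpha)$, $n=0,1,2,\dots$, are the monic orthogonal polynomials of degree $n$ with respect to $w(\cdot;t,\alpha)$: $\int_0^\infty P_j(x;t,\alpha)P_k(x;t,\alpha)w(x;t,\alpha)\,dx=h_j(t,\alpha)\delta_{jk}$, with $h_j(t,\alpha)>0$. The recurrence coefficients $\alpha_n(t,\alpha)$, $\beta_n(t,\alpha)$ (not to be confused with the parameter $\alpha$, which is never subscripted) are defined by $xP_n(x;t,\alpha)=P_{n+1}(x;t,\alpha)+\alpha_n(t,\alpha)P_n(x;t,\alpha)+\beta_n(t,\alpha)P_{n-1}(x;t,\alpha)$ with $P_0=1$, $\beta_0P_{-1}=0$.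
   Formalization: In (iii) the outer bounds a_n < x_{1,n} and x_{n,n} < b_n are proved strictly only for ε > 0; for ε = 0 they are proved with ≤, since strictness fails there (for n = 2, c_2 = 1 and a_2 = x_{1,2}, b_2 = x_{2,2}). *)

theory Defs
  imports "HOL-Analysis.Analysis" "HOL-Computational_Algebra.Polynomial"
begin

section \<open>Monic orthogonal polynomials on the positive half-line\<close>

definition is_monic_OPS :: "(real \<Rightarrow> real) \<Rightarrow> (nat \<Rightarrow> real poly) \<Rightarrow> bool" where
  "is_monic_OPS w p \<longleftrightarrow>
     (\<forall>n. degree (p n) = n \<and> lead_coeff (p n) = 1) \<and>
     (\<exists>h :: nat \<Rightarrow> real. (\<forall>j. h j > 0) \<and>
        (\<forall>j k. set_integrable lborel {0<..} (\<lambda>x. poly (p j) x * poly (p k) x * w x) \<and>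
               (LBINT x:{0<..}. poly (p j) x * poly (p k) x * w x) = (if j = k then h j else 0)))"

definition monic_OPS :: "(real \<Rightarrow> real) \<Rightarrow> nat \<Rightarrow> real poly" where
  "monic_OPS w = (THE p. is_monic_OPS w p)"

text \<open>The term $\beta_0 P_{-1}$ is $0$ by convention, so the recurrence leaves $\beta_0$ free;
  it is set to $0$ to make the pair of coefficient sequences unique.\<close>

definition is_recurrence :: "(nat \<Rightarrow> real poly) \<Rightarrow> (nat \<Rightarrow> real) \<Rightarrow> (nat \<Rightarrow> real) \<Rightarrow> bool" where
  "is_recurrence p a b \<longleftrightarrow> b 0 = 0 \<and>
     (\<forall>n. [:0, 1:] * p n =
        p (Suc n) + smult (a n) (p n) + (if n = 0 then 0 else smult (b n) (p (n - 1))))"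

definition rec_alpha :: "(nat \<Rightarrow> real poly) \<Rightarrow> nat \<Rightarrow> real" where
  "rec_alpha p = (THE a. \<exists>b. is_recurrence p a b)"

definition rec_beta :: "(nat \<Rightarrow> real poly) \<Rightarrow> nat \<Rightarrow> real" where
  "rec_beta p = (THE b. \<exists>a. is_recurrence p a b)"

section \<open>The singularly perturbed Laguerre weight\<close>

definition pL_weight :: "real \<Rightarrow> real \<Rightarrow> real \<Rightarrow> real" where
  "pL_weight t \<alpha> x = x powr \<alpha> * exp (- x - t / x)"

definition pL_poly :: "nat \<Rightarrow> real \<Rightarrow> real \<Rightarrow> real poly" where
  "pL_poly n t \<alpha> = monic_OPS (pL_weight t \<alpha>) n"

definition pL_alpha :: "nat \<Rightarrow> real \<Rightarrow> real \<Rightarrow> real" where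
  "pL_alpha n t \<alpha> = rec_alpha (\<lambda>k. pL_poly k t \<alpha>) n"

definition pL_beta :: "nat \<Rightarrow> real \<Rightarrow> real \<Rightarrow> real" where
  "pL_beta n t \<alpha> = rec_beta (\<lambda>k. pL_poly k t \<alpha>) n"

text \<open>\<open>pL_zero j n t \<alpha>\<close> is $x_{j,n}$, the \<open>j\<close>-th smallest real zero of the \<open>n\<close>-th polynomial,
  counted from \<open>j = 1\<close>; it is meaningful for \<open>1 \<le> j \<le> n\<close> because there are \<open>n\<close> distinct real zeros.\<close>

definition pL_zero :: "nat \<Rightarrow> nat \<Rightarrow> real \<Rightarrow> real \<Rightarrow> real" where
  "pL_zero j n t \<alpha> = sorted_list_of_set {x. poly (pL_poly n t \<alpha>) x = 0} ! (j - 1)"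

section \<open>The quantities in the bounds\<close>

definition pL_c :: "nat \<Rightarrow> real \<Rightarrow> real" where
  "pL_c n \<epsilon> = 4 * (cos (pi / (real n + 1)))\<^sup>2 + \<epsilon>"

definition pL_a :: "nat \<Rightarrow> real \<Rightarrow> real \<Rightarrow> real \<Rightarrow> real" where
  "pL_a n \<epsilon> t \<alpha> = (MIN k\<in>{1..n - 1}.
     (pL_alpha k t \<alpha> + pL_alpha (k - 1) t \<alpha>) / 2
     - sqrt ((pL_alpha k t \<alpha> - pL_alpha (k - 1) t \<alpha>)\<^sup>2 + 4 * pL_c n \<epsilon> * pL_beta k t \<alpha>) / 2)"

definition pL_b :: "nat \<Rightarrow> real \<Rightarrow> real \<Rightarrow> real \<Rightarrow> real" where
  "pL_b n \<epsilon> t \<alpha> = (MAX k\<in>{1..n - 1}.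
     (pL_alpha k t \<alpha> + pL_alpha (k - 1) t \<alpha>) / 2
     + sqrt ((pL_alpha k t \<alpha> - pL_alpha (k - 1) t \<alpha>)\<^sup>2 + 4 * pL_c n \<epsilon> * pL_beta k t \<alpha>) / 2)"

definition pL_d :: "nat \<Rightarrow> real \<Rightarrow> real \<Rightarrow> real" where
  "pL_d n t \<alpha> =
     poly (pL_poly n t \<alpha>) 0 / poly (pL_poly (n - 1) t \<alpha>) 0
     + poly (pL_poly (n - 1) t (\<alpha> + 1)) 0 / poly (pL_poly (n - 2) t (\<alpha> + 1)) 0"

definition pL_e :: "nat \<Rightarrow> real \<Rightarrow> real \<Rightarrow> real" where
  "pL_e n t \<alpha> =
     (poly (pL_poly (n - 1) t \<alpha>) 0 / poly (pL_poly (n - 2) t \<alpha>) 0)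
     * (poly (pL_poly (n - 1) t (\<alpha> + 1)) 0 / poly (pL_poly (n - 2) t (\<alpha> + 1)) 0)"

end

theory Submission
  imports Defs "HOL-Computational_Algebra.Fundamental_Theorem_Algebra"
begin

text \<open>
  Everything follows from Gauss quadrature. Let \<open>a\<close> and \<open>b\<close> be zeros of two orthogonal polynomials
  and let \<open>q\<close> vanish at the zeros of the first that are smaller than \<open>a\<close> and at the zeros of the
  second that are larger than \<open>b\<close>. As long as \<open>q\<close> has small degree, quadrature shows that
  \<open>(x - a) q\<^sup>2\<close> has nonnegative and \<open>(x - b) q\<^sup>2\<close> has nonpositive integral, whence \<open>a \<le> b\<close>.
  Degrees \<open>n\<close> and \<open>n - 1\<close> for the same weight give interlacing; degree \<open>n\<close> for two weights with
  increasing ratio gives monotonicity in the parameters, without differentiating the zeros.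

  The points in the inner bounds are weighted means of the zeros \<open>z\<close> of \<open>P n\<close>: for \<open>\<alpha>\<^bsub>n-1\<^esub>\<close> the
  weights are \<open>\<lambda>\<^sub>z P\<^bsub>n-1\<^esub>(z)\<^sup>2\<close> with the Christoffel numbers \<open>\<lambda>\<^sub>z\<close>. For the mixed point \<open>c\<close> of the last
  bound they are \<open>\<lambda>\<^sub>z P\<^bsub>n-1\<^esub>(z)\<^sup>2 / z\<^sup>2\<close>: applying Christoffel's formula twice gives a polynomial \<open>R\<close> of
  degree \<open>n - 2\<close> for which \<open>z\<^sup>2 R(z)\<close> is proportional to \<open>(z - c) P\<^bsub>n-1\<^esub>(z)\<close>, and \<open>R\<close> is orthogonal
  to \<open>P\<^bsub>n-1\<^esub>\<close>. The outer bounds compare the three-term recurrence with that of the Chebyshev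
  polynomials at \<open>cos (\<pi> / (n + 1))\<close>.
\<close>

section \<open>Integrals of polynomials against a positive weight\<close>

lemma set_integral_pos:
  fixes f :: "real \<Rightarrow> real"
  assumes int: "set_integrable lborel {0<..} f"
    and nonneg: "\<And>x. x > 0 \<Longrightarrow> f x \<ge> 0"
    and fin: "finite {x. x > 0 \<and> f x = 0}"
  shows "0 < (LBINT x:{0<..}. f x)"
proof -
  let ?g = "\<lambda>x. indicator {0<..} x *\<^sub>R f x"
  have nn: "0 \<le> ?g x" for x
    using nonneg by (auto simp: indicator_def)
  have "\<not> (AE x in lborel. ?g x = 0)"
  proof
    assume z: "AE x in lborel. ?g x = 0"
    have "AE x in lborel. x \<notin> {x. x > 0 \<and> f x = 0}"
      by (intro AE_not_in) (rule finite_imp_null_set_lborel[OF fin])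
    with z have "AE x in lborel. x \<notin> {0<..<1::real}"
      by eventually_elim (auto simp: indicator_def split: if_splits)
    then have "emeasure lborel {0<..<1::real} = 0"
      by (subst (asm) AE_iff_measurable[where N = "{0<..<1}"]) auto
    then show False by simp
  qed
  moreover have "integrable lborel ?g"
    using int by (simp add: set_integrable_def)
  ultimately have "integral\<^sup>L lborel ?g \<noteq> 0"
    using integral_nonneg_eq_0_iff_AE[of lborel ?g] nn by auto
  moreover have "integral\<^sup>L lborel ?g \<ge> 0"
    using nn by (intro integral_nonneg_AE) auto
  ultimately show ?thesis
    unfolding set_lebesgue_integral_def by linarith
qed

section \<open>The integration functional and orthogonality to lower degrees\<close>

definition wint :: "(real \<Rightarrow> real) \<Rightarrow> real poly \<Rightarrow> real" where
  "wint w p = (LBINT x:{0<..}. poly p x * w x)"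

text \<open>Orthogonality is tested against all polynomials of lower degree instead of pairwise
  within a sequence, so that each degree can be handled on its own. \<open>is_monic_OPS_iff\<close>
  reconciles the two versions.\<close>

definition orth :: "(real \<Rightarrow> real) \<Rightarrow> nat \<Rightarrow> real poly \<Rightarrow> bool" where
  "orth w n p \<longleftrightarrow> degree p = n \<and> coeff p n = 1 \<and> (\<forall>q. degree q < n \<longrightarrow> wint w (p * q) = 0)"

lemma orth_nonzero: "orth w n p \<Longrightarrow> p \<noteq> 0"
  by (auto simp: orth_def)

lemma monic_degree_0: "degree p = 0 \<Longrightarrow> coeff p 0 = 1 \<Longrightarrow> p = 1"
  by (auto elim!: degree_eq_zeroE)

text \<open>One step of division by a monic polynomial: the coefficients at \<open>n\<close> cancel.
  The case \<open>n = 0\<close> is excluded because no degree lies below 0.\<close>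

lemma degree_diff_smult_less:
  fixes p q :: "'a::comm_ring_1 poly"
  assumes "degree q = n" "coeff q n = 1" "degree p \<le> n" "n > 0"
  shows "degree (p - smult (coeff p n) q) < n"
proof (rule degree_lessI)
  show "p - smult (coeff p n) q \<noteq> 0 \<or> 0 < n" using assms by simp
  show "\<forall>k\<ge>n. coeff (p - smult (coeff p n) q) k = 0"
    using assms by (auto simp: le_less coeff_eq_0)
qed

text \<open>The weight is kept abstract because several weights occur at once: two parameter values
  are compared for monotonicity, and \<open>w\<close> is paired with \<open>x * w\<close> for the
  mixed bound.\<close>

locale pos_weight =
  fixes w :: "real \<Rightarrow> real"
  assumes w_pos: "\<And>x. x > 0 \<Longrightarrow> w x > 0"
    and w_int: "\<And>p. set_integrable lborel {0<..} (\<lambda>x. poly p x * w x)"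
begin

lemma wint_add: "wint w (p + q) = wint w p + wint w q"
  using set_integral_add(2)[OF w_int w_int, of p q] by (simp add: wint_def ring_distribs)

lemma wint_diff: "wint w (p - q) = wint w p - wint w q"
  using set_integral_diff(2)[OF w_int w_int, of p q] by (simp add: wint_def ring_distribs)

lemma wint_smult: "wint w (smult c p) = c * wint w p"
  by (simp add: wint_def mult.assoc)

lemma wint_0: "wint w 0 = 0"
  by (simp add: wint_def)

lemma wint_sum: "wint w (\<Sum>i\<in>A. f i) = (\<Sum>i\<in>A. wint w (f i))"
  by (induction A rule: infinite_finite_induct) (simp_all add: wint_0 wint_add)

lemmas wint_linear = wint_add wint_diff wint_smult wint_0 ring_distribs

lemma wint_pos:
  assumes "p \<noteq> 0" "\<And>x. x > 0 \<Longrightarrow> poly p x \<ge> 0"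
  shows "wint w p > 0"
  unfolding wint_def
proof (rule set_integral_pos[OF w_int])
  show "poly p x * w x \<ge> 0" if "x > 0" for x
    using that assms w_pos by (simp add: less_imp_le)
  have "{x. x > 0 \<and> poly p x * w x = 0} \<subseteq> {x. poly p x = 0}"
    using w_pos by force
  then show "finite {x. x > 0 \<and> poly p x * w x = 0}"
    using poly_roots_finite[OF \<open>p \<noteq> 0\<close>] finite_subset by blast
qed

lemma wint_square_pos: "p \<noteq> 0 \<Longrightarrow> wint w (p * p) > 0"
  by (rule wint_pos) auto

text \<open>Both candidates are orthogonal to their difference, which has lower degree; its square
  then has integral 0.\<close>

lemma orth_unique:
  assumes "orth w n p" "orth w n q"
  shows "p = q"
proof (rule ccontr)
  assume "p \<noteq> q"
  have "n > 0"
    using assms \<open>p \<noteq> q\<close> monic_degree_0 unfolding orth_def by (metis gr0I)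
  have "degree (p - q) < n"
    using degree_diff_smult_less[of q n p] assms \<open>n > 0\<close> by (auto simp: orth_def)
  then have "wint w (p * (p - q)) = 0" "wint w (q * (p - q)) = 0"
    using assms by (auto simp: orth_def)
  then have "wint w ((p - q) * (p - q)) = 0"
    by (simp add: wint_diff left_diff_distrib)
  with wint_square_pos[of "p - q"] \<open>p \<noteq> q\<close> show False by simp
qed

section \<open>Existence of monic orthogonal polynomials by Gram-Schmidt\<close>

lemma orth_0: "orth w 0 1"
  by (simp add: orth_def)

lemma orth_1: "orth w 1 [:- (wint w [:0, 1:] / wint w 1), 1:]"
proof -
  have "wint w 1 > 0" by (rule wint_pos) auto
  have "wint w ([:- (wint w [:0, 1:] / wint w 1), 1:] * q) = 0" if "degree q < 1" for q
  proof -
    from that obtain c where q: "q = [:c:]" by (auto dest: degree_eq_zeroE)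
    have eq: "[:- (wint w [:0, 1:] / wint w 1), 1:] * q = smult c ([:0, 1:] - smult (wint w [:0, 1:] / wint w 1) 1)"
      by (simp add: q)
    show ?thesis
      unfolding eq using \<open>wint w 1 > 0\<close> by (simp only: wint_linear) simp
  qed
  then show ?thesis by (simp add: orth_def)
qed

text \<open>Gram-Schmidt applied to \<open>x * p'\<close>. Only the components along
  \<open>p'\<close> and \<open>p\<close> have to be removed: against \<open>q\<close> of degree
  below \<open>n\<close>, the factor \<open>x\<close> can be moved onto \<open>q\<close>, whose
  degree then stays below that of \<open>p'\<close>.\<close>

lemma orth_step:
  assumes p: "orth w n p" and p': "orth w (Suc n) p'"
  defines "a \<equiv> wint w ([:0, 1:] * p' * p') / wint w (p' * p')"
    and "b \<equiv> wint w (p' * p') / wint w (p * p)"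
  shows "orth w (Suc (Suc n)) ([:0, 1:] * p' - smult a p' - smult b p)"
proof -
  define r where "r = [:0, 1:] * p' - smult a p' - smult b p"
  have nz: "p \<noteq> 0" "p' \<noteq> 0" using p p' orth_nonzero by blast+
  have hp: "wint w (p * p) > 0" "wint w (p' * p') > 0"
    using nz by (auto intro: wint_square_pos)
  have r_eq: "r = pCons 0 p' - (smult a p' + smult b p)"
    by (simp add: r_def algebra_simps)
  have pd: "degree p = n" "degree p' = Suc n" "coeff p' (Suc n) = 1"
    using p p' unfolding orth_def by auto
  then have lc: "coeff r (Suc (Suc n)) = 1"
    by (simp add: r_eq coeff_eq_0)
  moreover have "degree r \<le> Suc (Suc n)"
    using pd nz unfolding r_eq
    by (intro degree_diff_le degree_add_le) auto
  ultimately have deg: "degree r = Suc (Suc n)"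
    using le_degree[of r "Suc (Suc n)"] by simp
  have pp': "wint w (p' * p) = 0" "wint w (p * p') = 0"
    using p p' by (auto simp: orth_def mult.commute[of p p'])
  have rp': "wint w (r * p') = 0"
    using hp pp' by (simp add: r_def a_def wint_linear)
  have rp: "wint w (r * p) = 0"
  proof -
    \<comment> \<open>\<open>x * p\<close> and \<open>p'\<close> have the same leading term, so
      their difference is orthogonal to \<open>p'\<close>. This is why \<open>b\<close> has the
      squared norm of \<open>p'\<close> as its numerator.\<close>
    have "degree (pCons 0 p - p') < Suc n"
      using degree_diff_smult_less[of p' "Suc n" "pCons 0 p"] p p' nz
      by (auto simp: orth_def)
    then have "wint w (p' * (pCons 0 p - p')) = 0" using p' by (auto simp: orth_def)
    then have "wint w ([:0, 1:] * p' * p) = wint w (p' * p')"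
      by (simp add: wint_linear)
    then show ?thesis using hp pp' by (simp add: r_def b_def wint_linear)
  qed
  have low: "wint w (r * q) = 0" if "degree q < n" for q
  proof -
    have "degree (pCons 0 q) < Suc n" using that degree_pCons_le[of 0 q] by simp
    then have "wint w (p' * pCons 0 q) = 0" using p' unfolding orth_def by blast
    moreover have "wint w (p' * q) = 0" "wint w (p * q) = 0"
      using p p' that by (auto simp: orth_def)
    ultimately show ?thesis by (simp add: r_def wint_linear)
  qed
  have "wint w (r * q) = 0" if "degree q < Suc (Suc n)" for q
  proof -
    define s where "s = q - smult (coeff q (Suc n)) p'"
    have s: "degree s < Suc n"
      unfolding s_def using p' that by (intro degree_diff_smult_less) (auto simp: orth_def)
    have "wint w (r * s) = 0"
    proof (cases "n = 0")
      case True
      then have "p = 1" using p by (intro monic_degree_0) (auto simp: orth_def)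
      moreover from s True obtain c where "s = [:c:]" by (auto dest: degree_eq_zeroE)
      ultimately have "r * s = smult c (r * p)" by simp
      then show ?thesis using rp by (simp add: wint_linear)
    next
      case False
      have "degree (s - smult (coeff s n) p) < n"
        using p s False by (intro degree_diff_smult_less) (auto simp: orth_def)
      from low[OF this] rp show ?thesis by (simp add: wint_linear)
    qed
    moreover have "r * q = r * s + smult (coeff q (Suc n)) (r * p')"
      by (simp add: s_def algebra_simps)
    ultimately show ?thesis using rp' by (simp add: wint_linear)
  qed
  with deg lc show ?thesis by (simp add: orth_def r_def)
qed

lemma orth_exists: "\<exists>p. orth w n p"
proof (induction n rule: induct_nat_012)
  case 0 show ?case using orth_0 by blast
next
  case 1 show ?case using orth_1 by auto
next
  case (ge2 n) then show ?case using orth_step by blast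
qed

lemma is_monic_OPS_iff: "is_monic_OPS w p \<longleftrightarrow> (\<forall>n. orth w n (p n))"
proof
  assume L: "is_monic_OPS w p"
  have d: "degree (p n) = n" and c: "coeff (p n) n = 1" for n
    using L unfolding is_monic_OPS_def by (blast, metis)
  \<comment> \<open>Strong induction on \<open>degree q\<close>: subtracting a multiple of
    \<open>p (degree q)\<close> lowers the degree, and pairwise orthogonality disposes of the
    subtracted part.\<close>
  have *: "wint w (p n * q) = 0" if "degree q < n" for n q
    using that
  proof (induction "degree q" arbitrary: q rule: less_induct)
    case less
    define s where "s = q - smult (coeff q (degree q)) (p (degree q))"
    have ort: "wint w (p n * p (degree q)) = 0"
      using L less.prems unfolding is_monic_OPS_def wint_def by (auto simp: mult.assoc)
    have "wint w (p n * s) = 0"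
    proof (cases "degree q = 0")
      case True
      then have "p (degree q) = 1" using d c by (intro monic_degree_0) (metis True)+
      moreover from True obtain c where "q = [:c:]" by (rule degree_eq_zeroE)
      ultimately have "s = 0" by (simp add: s_def)
      then show ?thesis by (simp add: wint_0)
    next
      case False
      then have "degree s < degree q"
        unfolding s_def using d c by (intro degree_diff_smult_less) auto
      then show ?thesis using less by simp
    qed
    moreover have "p n * q = p n * s + smult (lead_coeff q) (p n * p (degree q))"
      by (simp add: s_def algebra_simps)
    ultimately show ?case using ort by (simp add: wint_linear)
  qed
  show "\<forall>n. orth w n (p n)"
    using d c * by (simp add: orth_def)
next
  assume R: "\<forall>n. orth w n (p n)"
  have "wint w (p j * p k) = 0" if "j \<noteq> k" for j k
  proof (cases "j < k")
    case True
    then have "wint w (p k * p j) = 0" using R by (simp add: orth_def)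
    then show ?thesis by (simp add: mult.commute)
  qed (use R that in \<open>auto simp: orth_def\<close>)
  moreover have "wint w (p j * p j) > 0" for j
    using R orth_nonzero by (intro wint_square_pos) blast
  moreover have "set_integrable lborel {0<..} (\<lambda>x. poly (p j) x * poly (p k) x * w x)" for j k
    using w_int[of "p j * p k"] by simp
  moreover have "degree (p n) = n" "coeff (p n) n = 1" for n
    using R by (simp_all add: orth_def)
  ultimately show "is_monic_OPS w p"
    unfolding is_monic_OPS_def wint_def
    by (intro conjI exI[of _ "\<lambda>j. wint w (p j * p j)"]) (simp_all add: wint_def)
qed

section \<open>The polynomials \<open>P n\<close> and their recurrence coefficients\<close>

abbreviation P :: "nat \<Rightarrow> real poly" where "P \<equiv> monic_OPS w"

lemma orth_P: "orth w n (P n)"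
proof -
  obtain p where p: "\<And>n. orth w n (p n)" using orth_exists by metis
  have "monic_OPS w = p"
    unfolding monic_OPS_def is_monic_OPS_iff using p by (intro the_equality ext) (auto intro: orth_unique)
  then show ?thesis using p by simp
qed

lemma degree_P [simp]: "degree (P n) = n"
  and coeff_P [simp]: "coeff (P n) n = 1"
  and P_nonzero [simp]: "P n \<noteq> 0"
  and P_orth: "degree q < n \<Longrightarrow> wint w (P n * q) = 0"
  using orth_P[of n] orth_nonzero[OF orth_P, of n] by (simp_all add: orth_def)

lemma P_eqI: "orth w n p \<Longrightarrow> P n = p"
  by (rule orth_unique[OF orth_P])

lemma P_0 [simp]: "P 0 = 1"
  by (rule P_eqI[OF orth_0])

text \<open>\<open>orth_step\<close> read backwards. There \<open>b\<close> is a quotient of squared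
  norms, which gives the positivity needed for the absence of common zeros and for the outer
  bounds.\<close>

lemma recurrence_exists:
  "\<exists>a b. is_recurrence P a b \<and> (\<forall>n>0. b n > 0)"
proof -
  define Q where "Q n a b \<longleftrightarrow>
      [:0, 1:] * P n = P (Suc n) + smult a (P n) + (if n = 0 then 0 else smult b (P (n - 1)))
     \<and> (n > 0 \<longrightarrow> b > 0) \<and> (n = 0 \<longrightarrow> b = 0)" for n a b
  have "\<exists>a b. Q n a b" for n
  proof (cases n)
    case 0
    have "P 1 = [:- (wint w [:0, 1:] / wint w 1), 1:]" by (rule P_eqI[OF orth_1])
    then show ?thesis using 0 by (intro exI[of _ "wint w [:0, 1:] / wint w 1"] exI[of _ 0]) (simp add: Q_def)
  next
    case (Suc m)
    define a where "a = wint w ([:0, 1:] * P n * P n) / wint w (P n * P n)"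
    define b where "b = wint w (P n * P n) / wint w (P m * P m)"
    have "P (Suc n) = [:0, 1:] * P n - smult a (P n) - smult b (P m)"
      unfolding a_def b_def Suc by (rule P_eqI[OF orth_step[OF orth_P orth_P]])
    then have "[:0, 1:] * P n = P (Suc n) + smult a (P n) + smult b (P m)"
      by simp
    moreover have "b > 0" by (simp add: b_def wint_square_pos)
    ultimately have "Q n a b" unfolding Q_def using Suc by simp
    then show ?thesis by blast
  qed
  then obtain a b where "\<And>n. Q n (a n) (b n)" by metis
  then show ?thesis unfolding is_recurrence_def Q_def by blast
qed

text \<open>\<open>P n\<close> and \<open>P (n - 1)\<close> have different degrees, so the
  coefficients at \<open>n\<close> and then at \<open>n - 1\<close> determine both sequences; at
  index 0 the convention \<open>b 0 = 0\<close> decides.\<close>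

lemma recurrence_unique:
  assumes "is_recurrence P a b" "is_recurrence P a' b'"
  shows "a = a' \<and> b = b'"
proof -
  have "a n = a' n \<and> b n = b' n" for n
  proof -
    have eq: "smult (a n) (P n) + (if n = 0 then 0 else smult (b n) (P (n - 1)))
      = smult (a' n) (P n) + (if n = 0 then 0 else smult (b' n) (P (n - 1)))"
    proof -
      have "P (Suc n) + (smult (a n) (P n) + (if n = 0 then 0 else smult (b n) (P (n - 1))))
        = P (Suc n) + (smult (a' n) (P n) + (if n = 0 then 0 else smult (b' n) (P (n - 1))))"
        using assms unfolding is_recurrence_def add.assoc[symmetric] by simp
      then show ?thesis by simp
    qed
    from arg_cong[OF this, of "\<lambda>p. coeff p n"] have "a n = a' n"
      by (auto simp: coeff_eq_0 split: if_splits)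
    moreover have "b n = b' n"
    proof (cases "n = 0")
      case True
      then show ?thesis using assms by (simp add: is_recurrence_def)
    next
      case False
      with eq \<open>a n = a' n\<close> have "smult (b n) (P (n - 1)) = smult (b' n) (P (n - 1))" by simp
      from arg_cong[OF this, of "\<lambda>p. coeff p (n - 1)"] show ?thesis by simp
    qed
    ultimately show ?thesis ..
  qed
  then show ?thesis by auto
qed

lemma is_recurrence_rec: "is_recurrence P (rec_alpha P) (rec_beta P)"
  and rec_beta_pos: "n > 0 \<Longrightarrow> rec_beta P n > 0"
proof -
  obtain a b where ab: "is_recurrence P a b" "\<forall>n>0. b n > 0"
    using recurrence_exists by blast
  have "rec_alpha P = a" "rec_beta P = b"
    unfolding rec_alpha_def rec_beta_def using ab recurrence_unique by (intro the_equality; blast)+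
  then show "is_recurrence P (rec_alpha P) (rec_beta P)" "n > 0 \<Longrightarrow> rec_beta P n > 0"
    using ab by auto
qed

end

section \<open>Zeros and Gauss quadrature\<close>

lemma poly_map_of_real: "poly (map_poly complex_of_real p) (of_real x) = of_real (poly p x)"
  by (induction p) (simp_all add: map_poly_pCons)

text \<open>The divisor is \<open>(x - z) * (x - cnj z)\<close>. The remainder is real of degree at
  most 1 and vanishes at a nonreal point, so it is 0.\<close>

lemma real_poly_nonreal_root_dvd:
  fixes p :: "real poly"
  assumes "poly (map_poly complex_of_real p) z = 0" "Im z \<noteq> 0"
  shows "[:(Re z)\<^sup>2 + (Im z)\<^sup>2, - 2 * Re z, 1:] dvd p"
proof -
  define f where "f = [:(Re z)\<^sup>2 + (Im z)\<^sup>2, - 2 * Re z, 1:]"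
  define r where "r = p mod f"
  have hom: "poly (map_poly complex_of_real (g * h)) z = poly (map_poly complex_of_real g) z * poly (map_poly complex_of_real h) z"
    "poly (map_poly complex_of_real (g + h)) z = poly (map_poly complex_of_real g) z + poly (map_poly complex_of_real h) z" for g h
  proof -
    have add: "map_poly complex_of_real (g + h) = map_poly complex_of_real g + map_poly complex_of_real h" for g h
      by (intro poly_eqI) (simp add: coeff_map_poly)
    have "map_poly complex_of_real (g * h) = map_poly complex_of_real g * map_poly complex_of_real h"
      by (intro poly_eqI) (simp add: coeff_map_poly coeff_mult)
    with add show "poly (map_poly complex_of_real (g * h)) z = poly (map_poly complex_of_real g) z * poly (map_poly complex_of_real h) z"
      "poly (map_poly complex_of_real (g + h)) z = poly (map_poly complex_of_real g) z + poly (map_poly complex_of_real h) z"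
      by simp_all
  qed
  have fz: "poly (map_poly complex_of_real f) z = 0"
    by (simp add: f_def map_poly_pCons complex_eq_iff power2_eq_square algebra_simps)
  have "poly (map_poly complex_of_real r) z = 0"
    using assms(1) hom(2)[of "p div f * f" r] hom(1)[of "p div f" f] fz by (simp add: r_def)
  moreover have "degree r < 2"
    using degree_mod_less[of f p] by (auto simp: r_def f_def)
  then obtain c0 c1 where r: "r = [:c0, c1:]"
  proof -
    assume "degree r < 2"
    then have "r = [:coeff r 0, coeff r 1:]"
      by (intro poly_eqI) (auto simp: coeff_pCons coeff_eq_0 split: nat.split)
    then show ?thesis using that by blast
  qed
  ultimately have "c1 = 0 \<and> c0 = 0"
    using assms(2) by (auto simp: map_poly_pCons complex_eq_iff)
  then have "r = 0" by (simp add: r)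
  then show ?thesis by (simp add: r_def f_def mod_eq_0_iff_dvd)
qed

lemma pderiv_map_of_real:
  "pderiv (map_poly complex_of_real p) = map_poly complex_of_real (pderiv p)"
  by (intro poly_eqI) (simp add: coeff_pderiv coeff_map_poly)

section \<open>Lagrange interpolation\<close>

definition lagrange :: "real set \<Rightarrow> real \<Rightarrow> real poly" where
  "lagrange Z z = smult (1 / (\<Prod>y\<in>Z - {z}. z - y)) (\<Prod>y\<in>Z - {z}. [:- y, 1:])"

lemma lagrange_degree: "finite Z \<Longrightarrow> z \<in> Z \<Longrightarrow> degree (lagrange Z z) < card Z"
  using card_gt_0_iff[of Z] by (auto simp: lagrange_def degree_prod_sum_eq card_Diff_singleton)

lemma poly_lagrange:
  assumes "finite Z" "z \<in> Z" "y \<in> Z"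
  shows "poly (lagrange Z z) y = (if y = z then 1 else 0)"
proof (cases "y = z")
  case True
  have "(\<Prod>y\<in>Z - {z}. z - y) \<noteq> 0" using assms by auto
  then show ?thesis using True by (simp add: lagrange_def poly_prod)
next
  case False
  then have "(\<Prod>x\<in>Z - {z}. y - x) = 0" using assms by auto
  then show ?thesis using False by (simp add: lagrange_def poly_prod)
qed

text \<open>The difference of the two sides vanishes on all of \<open>Z\<close> but has degree below
  \<open>card Z\<close>.\<close>

lemma lagrange_interpolation:
  fixes r :: "real poly"
  assumes "finite Z" "degree r < card Z"
  shows "r = (\<Sum>z\<in>Z. smult (poly r z) (lagrange Z z))"
proof (rule ccontr)
  define d where "d = r - (\<Sum>z\<in>Z. smult (poly r z) (lagrange Z z))"
  assume "\<not> ?thesis"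
  then have "d \<noteq> 0" by (simp add: d_def)
  have "poly d y = 0" if "y \<in> Z" for y
  proof -
    have "(\<Sum>z\<in>Z. poly r z * poly (lagrange Z z) y) = (\<Sum>z\<in>Z. if z = y then poly r z else 0)"
      using assms that by (intro sum.cong) (auto simp: poly_lagrange)
    then show ?thesis using assms that by (simp add: d_def poly_sum)
  qed
  then have "card Z \<le> card {x. poly d x = 0}"
    using poly_roots_finite[OF \<open>d \<noteq> 0\<close>] by (intro card_mono) auto
  also have "\<dots> \<le> degree d" by (rule card_poly_roots_bound[OF \<open>d \<noteq> 0\<close>])
  also have "\<dots> < card Z"
    unfolding d_def using assms lagrange_degree
    by (intro degree_diff_less degree_sum_less) (auto intro: le_less_trans[OF degree_smult_le])
  finally show False by simp
qed

section \<open>Reality, positivity and simplicity of the zeros\<close>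

context pos_weight
begin

text \<open>Here \<open>q\<close> has lower degree than \<open>P n\<close>, so
  \<open>P n * q\<close> has integral 0, yet it equals \<open>f * q * q\<close>, which is
  nonnegative on the half-line. The choices of \<open>f\<close> below exclude nonpositive, double
  and nonreal roots in turn.\<close>

lemma P_no_nonneg_factor:
  assumes "P n = f * q" "degree f > 0" "\<And>x. x > 0 \<Longrightarrow> poly f x \<ge> 0"
  shows False
proof -
  have nz: "f \<noteq> 0" "q \<noteq> 0" using P_nonzero[of n] assms(1) by auto
  have "n = degree f + degree q" using degree_P[of n] assms(1) nz by (simp add: degree_mult_eq)
  then have "wint w (P n * q) = 0" using assms(2) by (intro P_orth) simp
  moreover have "wint w (P n * q) > 0"
    unfolding assms(1) mult.assoc using nz assms(3) by (intro wint_pos) auto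
  ultimately show False by simp
qed

lemma P_roots_pos: "poly (P n) x = 0 \<Longrightarrow> x > 0"
  using P_no_nonneg_factor[of n "[:- x, 1:]"] by (force simp: poly_eq_0_iff_dvd dvd_def)

lemma P_no_double_root: "\<not> (poly (P n) x = 0 \<and> poly (pderiv (P n)) x = 0)"
proof
  assume "poly (P n) x = 0 \<and> poly (pderiv (P n)) x = 0"
  then obtain q where q: "P n = [:- x, 1:] * q" and "poly (pderiv (P n)) x = 0"
    by (metis poly_eq_0_iff_dvd dvd_def)
  moreover have "poly (pderiv ([:- x, 1:] * q)) x = poly q x"
    unfolding pderiv_mult by (simp add: pderiv_pCons)
  ultimately have "poly q x = 0" by simp
  then obtain q' where "q = [:- x, 1:] * q'" by (metis poly_eq_0_iff_dvd dvd_def)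
  with q have "P n = ([:- x, 1:] * [:- x, 1:]) * q'" by (simp only: mult.assoc)
  then show False
    by (rule P_no_nonneg_factor) (simp add: degree_mult_eq del: mult_pCons_left, unfold poly_mult, rule zero_le_square)
qed

lemma P_complex_roots_real:
  assumes "poly (map_poly complex_of_real (P n)) z = 0"
  shows "z \<in> \<real>"
proof (rule ccontr)
  assume "z \<notin> \<real>"
  then have "Im z \<noteq> 0" by (simp add: complex_is_Real_iff)
  from real_poly_nonreal_root_dvd[OF assms this] obtain q
    where "P n = [:(Re z)\<^sup>2 + (Im z)\<^sup>2, - 2 * Re z, 1:] * q" by (rule dvdE)
  then show False
  proof (rule P_no_nonneg_factor)
    fix x :: real
    have "poly [:(Re z)\<^sup>2 + (Im z)\<^sup>2, - 2 * Re z, 1:] x = (x - Re z)\<^sup>2 + (Im z)\<^sup>2"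
      by (simp add: power2_eq_square algebra_simps)
    then show "poly [:(Re z)\<^sup>2 + (Im z)\<^sup>2, - 2 * Re z, 1:] x \<ge> 0"
      by (metis add_nonneg_nonneg zero_le_power2)
  qed simp
qed

definition zeros :: "nat \<Rightarrow> real set" where "zeros n = {x. poly (P n) x = 0}"

lemma finite_zeros [simp]: "finite (zeros n)"
  unfolding zeros_def by (rule poly_roots_finite[OF P_nonzero])

lemma zeros_pos: "z \<in> zeros n \<Longrightarrow> z > 0"
  by (simp add: zeros_def P_roots_pos)

lemma zeros_root [simp]: "z \<in> zeros n \<Longrightarrow> poly (P n) z = 0"
  by (simp add: zeros_def)

text \<open>Over the complex numbers \<open>P n\<close> splits into distinct linear factors, because
  a double root would be real and hence excluded. All these roots are images of real zeros.\<close>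

lemma card_zeros [simp]: "card (zeros n) = n"
proof -
  let ?p = "map_poly complex_of_real (P n)"
  have "rsquarefree ?p"
    unfolding rsquarefree_roots pderiv_map_of_real
  proof (intro allI notI)
    fix a assume a: "poly ?p a = 0 \<and> poly (map_poly complex_of_real (pderiv (P n))) a = 0"
    then obtain x where "a = of_real x" using P_complex_roots_real Reals_cases by blast
    with a P_no_double_root[of n x] show False by (simp add: poly_map_of_real)
  qed
  have "{z. poly ?p z = 0} = complex_of_real ` zeros n"
  proof (intro equalityI subsetI)
    fix z assume "z \<in> {z. poly ?p z = 0}"
    then have z: "poly ?p z = 0" by simp
    then obtain x where x: "z = of_real x"
      using P_complex_roots_real Reals_cases by blast
    from z have "poly (P n) x = 0" unfolding x poly_map_of_real by simp
    then show "z \<in> complex_of_real ` zeros n" unfolding x zeros_def by blast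
  next
    fix z assume "z \<in> complex_of_real ` zeros n"
    then obtain x where x: "z = of_real x" "poly (P n) x = 0" unfolding zeros_def by blast
    then have "poly ?p z = 0" unfolding x(1) poly_map_of_real x(2) by simp
    then show "z \<in> {z. poly ?p z = 0}" by blast
  qed
  then have card: "card {z. poly ?p z = 0} = card (zeros n)"
    using card_image[OF inj_on_subset[OF inj_of_real subset_UNIV]] by metis
  have deg: "degree ?p = n" by (simp add: degree_map_poly)
  then have lc: "lead_coeff ?p = 1" by (simp add: coeff_map_poly)
  have "n = degree (\<Prod>z|poly ?p z = 0. [:- z, 1:])"
    using complex_poly_decompose_rsquarefree[OF \<open>rsquarefree ?p\<close>] unfolding lc smult_1_left
    by (simp add: deg)
  also have "\<dots> = card {z. poly ?p z = 0}"
    by (subst degree_prod_sum_eq) simp_all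
  finally show ?thesis using card by simp
qed

section \<open>Christoffel numbers and Gauss quadrature\<close>

definition christoffel :: "nat \<Rightarrow> real \<Rightarrow> real" where
  "christoffel n z = wint w (lagrange (zeros n) z)"

text \<open>Division by \<open>P n\<close> leaves a quotient of degree below \<open>n\<close>, which
  orthogonality annihilates, and a remainder that agrees with \<open>f\<close> at the zeros and is
  interpolated exactly.\<close>

lemma gauss_quadrature:
  assumes "degree f < 2 * n"
  shows "wint w f = (\<Sum>z\<in>zeros n. christoffel n z * poly f z)"
proof -
  define r where "r = f mod P n"
  define s where "s = f div P n"
  have "n > 0" using assms by simp
  then have dr: "degree r < n"
    using degree_mod_less[of "P n" f] by (auto simp: r_def)
  have f: "f = P n * s + r" by (simp add: r_def s_def)
  have "degree s < n"
  proof (rule ccontr)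
    assume "\<not> ?thesis"
    then have "s \<noteq> 0" using \<open>n > 0\<close> by auto
    with \<open>\<not> degree s < n\<close> have "degree (P n * s) \<ge> 2 * n"
      by (simp add: degree_mult_eq)
    then have "degree f = degree (P n * s)"
      unfolding f using dr by (intro degree_add_eq_left) simp
    with \<open>degree (P n * s) \<ge> 2 * n\<close> assms show False by simp
  qed
  then have "wint w f = wint w r" by (simp add: f wint_add P_orth)
  also have "\<dots> = (\<Sum>z\<in>zeros n. poly r z * wint w (lagrange (zeros n) z))"
    by (subst lagrange_interpolation[of "zeros n" r]) (use dr in \<open>simp_all add: wint_sum wint_smult\<close>)
  also have "\<dots> = (\<Sum>z\<in>zeros n. christoffel n z * poly f z)"
    by (intro sum.cong) (simp_all add: f christoffel_def)
  finally show ?thesis .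
qed

text \<open>The square of a Lagrange basis polynomial has degree at most \<open>2 * n - 2\<close>,
  and its quadrature sum retains only the node \<open>z\<close>.\<close>

lemma christoffel_pos:
  assumes "z \<in> zeros n"
  shows "christoffel n z > 0"
proof -
  let ?l = "lagrange (zeros n) z"
  have l: "degree ?l < n" using lagrange_degree[of "zeros n" z] assms by simp
  have "?l \<noteq> 0" using poly_lagrange[of "zeros n" z z] assms by auto
  then have "0 < wint w (?l * ?l)" by (rule wint_square_pos)
  also have "\<dots> = (\<Sum>y\<in>zeros n. christoffel n y * poly (?l * ?l) y)"
    using l by (intro gauss_quadrature) (use degree_mult_le[of ?l ?l] in linarith)
  also have "\<dots> = (\<Sum>y\<in>zeros n. if y = z then christoffel n y else 0)"
    using assms by (intro sum.cong) (auto simp: poly_lagrange)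
  also have "\<dots> = christoffel n z" using assms by simp
  finally show ?thesis .
qed

text \<open>In the quadrature sum \<open>q\<close> removes every node on the wrong side of
  \<open>a\<close>; the sign of \<open>\<sigma>\<close> selects the side. For strictness, if all
  terms vanished then \<open>q\<close> would have the \<open>n - 1\<close> zeros other than
  \<open>a\<close>, more than its degree allows.\<close>

lemma wint_shifted_square_nonneg:
  assumes "degree q < n" "\<And>z. z \<in> zeros n \<Longrightarrow> \<sigma> * (z - a) < 0 \<Longrightarrow> poly q z = 0"
  shows "\<sigma> * wint w ([:- a, 1:] * (q * q)) \<ge> 0"
    and "a \<in> zeros n \<Longrightarrow> degree q + 1 < n \<Longrightarrow> q \<noteq> 0 \<Longrightarrow> \<sigma> \<noteq> 0 \<Longrightarrow> \<sigma> * wint w ([:- a, 1:] * (q * q)) > 0"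
proof -
  define T where "T z = christoffel n z * (\<sigma> * (z - a) * (poly q z)\<^sup>2)" for z
  have "degree ([:- a, 1:] * (q * q)) \<le> 1 + (degree q + degree q)"
    using degree_mult_le[of "[:- a, 1:]" "q * q"] degree_mult_le[of q q] by simp
  then have "degree ([:- a, 1:] * (q * q)) < 2 * n"
    using assms(1) by simp
  from gauss_quadrature[OF this] have eq: "\<sigma> * wint w ([:- a, 1:] * (q * q)) = sum T (zeros n)"
    unfolding T_def by (simp add: power2_eq_square algebra_simps sum_distrib_left)
  have nn: "T z \<ge> 0" if "z \<in> zeros n" for z
    using assms(2)[OF that] christoffel_pos[OF that] unfolding T_def
    by (cases "\<sigma> * (z - a) < 0") auto
  show "\<sigma> * wint w ([:- a, 1:] * (q * q)) \<ge> 0"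
    unfolding eq using nn by (rule sum_nonneg)
  assume a: "a \<in> zeros n" "degree q + 1 < n" "q \<noteq> 0" "\<sigma> \<noteq> 0"
  have "sum T (zeros n) \<noteq> 0"
  proof
    assume "sum T (zeros n) = 0"
    then have T0: "T z = 0" if "z \<in> zeros n" for z
      using nn that sum_nonneg_eq_0_iff[of "zeros n" T] by auto
    have "poly q z = 0" if "z \<in> zeros n - {a}" for z
      using T0[of z] christoffel_pos[of z n] that a by (auto simp: T_def)
    then have "card (zeros n - {a}) \<le> card {x. poly q x = 0}"
      using poly_roots_finite[OF \<open>q \<noteq> 0\<close>] by (intro card_mono) auto
    also have "\<dots> \<le> degree q" by (rule card_poly_roots_bound[OF \<open>q \<noteq> 0\<close>])
    finally show False using a by (simp add: card_Diff_singleton)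
  qed
  moreover have "sum T (zeros n) \<ge> 0" using nn by (rule sum_nonneg)
  ultimately show "\<sigma> * wint w ([:- a, 1:] * (q * q)) > 0" unfolding eq by simp
qed

end

section \<open>Comparison of zeros\<close>

text \<open>Turns a position in the sorted list into counts of smaller and larger elements. The
  comparison lemmas use these counts as degrees of node polynomials.\<close>

lemma sorted_list_of_set_nth:
  fixes A :: "'a::linorder set"
  assumes "finite A" "i < card A"
  defines "a \<equiv> sorted_list_of_set A ! i"
  shows "a \<in> A" "card {z \<in> A. z < a} = i" "card {z \<in> A. a < z} = card A - Suc i"
proof -
  define xs where "xs = sorted_list_of_set A"
  have set: "set xs = A" and len: "length xs = card A" and srt: "sorted_wrt (<) xs" and dist: "distinct xs"
    using assms(1) by (simp_all add: xs_def)
  have a: "a = xs ! i" and i: "i < length xs"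
    using assms(2) by (simp_all add: a_def xs_def)
  show "a \<in> A" using i set nth_mem a by blast
  have mono: "xs ! j < xs ! k \<longleftrightarrow> j < k" if "j < length xs" "k < length xs" for j k
    using sorted_wrt_nth_less[OF srt] that by (metis less_asym' linorder_neqE_nat)
  have card_img: "card {z \<in> A. R z} = card {k. k < length xs \<and> R (xs ! k)}" for R
  proof -
    have "{z \<in> A. R z} = (!) xs ` {k. k < length xs \<and> R (xs ! k)}"
      unfolding set[symmetric] in_set_conv_nth by blast
    moreover have "inj_on ((!) xs) {k. k < length xs \<and> R (xs ! k)}"
      using dist by (auto simp: inj_on_def nth_eq_iff_index_eq)
    ultimately show ?thesis by (simp add: card_image)
  qed
  have "{k. k < length xs \<and> xs ! k < a} = {..<i}" "{k. k < length xs \<and> a < xs ! k} = {i<..<length xs}"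
    unfolding a using mono i by auto
  then show "card {z \<in> A. z < a} = i" "card {z \<in> A. a < z} = card A - Suc i"
    unfolding card_img by (simp_all add: len)
qed

text \<open>The last assumption makes \<open>c\<close> a weighted mean of \<open>S\<close>. If no
  element lay on one side of \<open>c\<close>, all terms of the sum would have one sign and vanish,
  forcing \<open>S\<close> into \<open>{c}\<close>.\<close>

lemma weighted_mean_strictly_between:
  fixes S :: "real set"
  assumes "finite S" "card S \<ge> 2" "\<And>z. z \<in> S \<Longrightarrow> m z > 0" "(\<Sum>z\<in>S. m z * (z - c)) = 0"
  shows "\<exists>z\<in>S. z < c" "\<exists>z\<in>S. z > c"
proof -
  have *: "\<exists>z\<in>S. \<sigma> * (z - c) < 0" if "\<sigma> \<noteq> 0" for \<sigma>
  proof (rule ccontr)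
    assume "\<not> ?thesis"
    then have nn: "m z * (\<sigma> * (z - c)) \<ge> 0" if "z \<in> S" for z
      using assms(3)[OF that] that by (meson less_imp_le linorder_not_le mult_nonneg_nonneg)
    have "(\<Sum>z\<in>S. m z * (\<sigma> * (z - c))) = \<sigma> * (\<Sum>z\<in>S. m z * (z - c))"
      by (simp add: sum_distrib_left mult_ac)
    then have "(\<Sum>z\<in>S. m z * (\<sigma> * (z - c))) = 0" using assms(4) by simp
    then have "m z * (\<sigma> * (z - c)) = 0" if "z \<in> S" for z
      using nn that assms(1) sum_nonneg_eq_0_iff[of S "\<lambda>z. m z * (\<sigma> * (z - c))"] by auto
    then have "S \<subseteq> {c}" using assms(3) \<open>\<sigma> \<noteq> 0\<close> by fastforce
    then have "card S \<le> 1" using card_mono[of "{c}" S] by simp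
    then show False using assms(2) by simp
  qed
  show "\<exists>z\<in>S. z < c" "\<exists>z\<in>S. z > c"
    using *[of 1] *[of "-1"] by auto
qed

section \<open>Separation of zeros for a single weight\<close>

definition node_poly :: "real set \<Rightarrow> real poly" where
  "node_poly A = (\<Prod>z\<in>A. [:- z, 1:])"

lemma node_poly_nonzero [simp]: "node_poly A \<noteq> 0"
  unfolding node_poly_def by (cases "finite A") simp_all

lemma degree_node_poly [simp]: "degree (node_poly A) = card A"
  by (simp add: node_poly_def degree_prod_sum_eq)

lemma poly_node_poly: "finite A \<Longrightarrow> z \<in> A \<Longrightarrow> poly (node_poly A) z = 0"
  by (simp add: node_poly_def poly_prod)

context pos_weight
begin

lemma wint_shift_diff:
  "wint w ([:- a, 1:] * q) - wint w ([:- b, 1:] * q) = (b - a) * wint w q"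
proof -
  have "[:- a, 1:] * q - [:- b, 1:] * q = smult (b - a) q"
    by (simp add: left_diff_distrib[symmetric] smult_diff_left)
  from arg_cong[OF this, of "wint w"] show ?thesis by (simp only: wint_diff wint_smult)
qed

text \<open>Quadrature with \<open>n\<close> nodes bounds the integral of
  \<open>(x - a) * q\<^sup>2\<close> below by 0, quadrature with \<open>m\<close> nodes bounds that
  of \<open>(x - b) * q\<^sup>2\<close> above by 0; their difference is \<open>b - a\<close> times a
  positive number.\<close>

lemma zeros_separated:
  assumes "a \<in> zeros n" "b \<in> zeros m"
    and "card {z \<in> zeros n. z < a} + card {z \<in> zeros m. b < z} = k"
    and "k < n" "k < m" "n \<noteq> m"
  shows "a < b"
proof -
  define q where "q = node_poly {z \<in> zeros n. z < a} * node_poly {z \<in> zeros m. b < z}"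
  have q: "q \<noteq> 0" "degree q = k"
    using assms(3) by (simp_all add: q_def degree_mult_eq)
  have va: "poly q z = 0" if "z \<in> zeros n" "1 * (z - a) < 0" for z
    using that by (simp add: q_def poly_node_poly)
  have vb: "poly q z = 0" if "z \<in> zeros m" "(- 1) * (z - b) < 0" for z
    using that by (simp add: q_def poly_node_poly)
  have "1 * wint w ([:- a, 1:] * (q * q)) \<ge> 0" "(- 1) * wint w ([:- b, 1:] * (q * q)) \<ge> 0"
    using wint_shifted_square_nonneg(1)[of q n 1 a] wint_shifted_square_nonneg(1)[of q m "- 1" b]
      q assms(4,5) va vb by blast+
  \<comment> \<open>Since \<open>k\<close> is below both of the distinct degrees, the larger one
    exceeds \<open>k + 1\<close>, and its quadrature gives a strict sign.\<close>
  moreover have "1 * wint w ([:- a, 1:] * (q * q)) > 0 \<or> (- 1) * wint w ([:- b, 1:] * (q * q)) > 0"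
  proof (cases "k + 1 < n")
    case True
    then show ?thesis
      using wint_shifted_square_nonneg(2)[of q n 1 a] q va assms(1,4) by (metis zero_neq_one)
  next
    case False
    then have "k + 1 < m" using assms(4-6) by linarith
    then show ?thesis
      using wint_shifted_square_nonneg(2)[of q m "- 1" b] q vb assms(2,5) by (metis neg_equal_0_iff_equal zero_neq_one)
  qed
  ultimately have "(b - a) * wint w (q * q) > 0"
    using wint_shift_diff[of a "q * q" b] by linarith
  moreover have "wint w (q * q) > 0" using q by (intro wint_square_pos)
  ultimately show ?thesis by (simp add: zero_less_mult_iff)
qed

section \<open>Zeros and the three-term recurrence\<close>

lemma recurrence:
  "[:0, 1:] * P n = P (Suc n) + smult (rec_alpha P n) (P n) + (if n = 0 then 0 else smult (rec_beta P n) (P (n - 1)))"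
  using is_recurrence_rec unfolding is_recurrence_def by blast

lemma poly_recurrence:
  "poly (P (Suc n)) x = (x - rec_alpha P n) * poly (P n) x - (if n = 0 then 0 else rec_beta P n * poly (P (n - 1)) x)"
  using arg_cong[OF recurrence[of n], of "\<lambda>p. poly p x"] by (simp add: algebra_simps split: if_splits)

text \<open>Because the \<beta> coefficients are nonzero, a common zero would descend through the
  recurrence to \<open>P 0 = 1\<close>.\<close>

lemma no_common_zero: "\<not> (poly (P n) x = 0 \<and> poly (P (Suc n)) x = 0)"
proof (induction n)
  case 0
  show ?case by simp
next
  case (Suc n)
  then show ?case
    using poly_recurrence[of "Suc n" x] rec_beta_pos[of "Suc n"] by auto
qed

lemma zeros_nonzero_pred:
  assumes "n > 0" "z \<in> zeros n"
  shows "poly (P (n - 1)) z \<noteq> 0"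
  using no_common_zero[of "n - 1" z] assms by simp

text \<open>Pairing the recurrence with \<open>P (n - 1)\<close> shows that
  \<open>(x - ?a) * ?p\<^sup>2\<close> has integral 0. Its degree \<open>2 * n - 1\<close> is just
  within reach of quadrature, which exhibits \<open>?a\<close> as a weighted mean of the
  zeros.\<close>

lemma rec_alpha_between_zeros:
  assumes "n \<ge> 2"
  shows "\<exists>z\<in>zeros n. z < rec_alpha P (n - 1)" "\<exists>z\<in>zeros n. z > rec_alpha P (n - 1)"
proof -
  let ?p = "P (n - 1)" and ?a = "rec_alpha P (n - 1)"
  have "wint w ([:0, 1:] * ?p * ?p) = ?a * wint w (?p * ?p)"
  proof -
    have "wint w (P n * ?p) = 0" using assms by (intro P_orth) simp
    moreover have "wint w (P (n - 2) * ?p) = 0"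
      using P_orth[of "P (n - 2)" "n - 1"] assms by (simp add: mult.commute)
    moreover have "[:0, 1:] * ?p = P n + smult ?a ?p + smult (rec_beta P (n - 1)) (P (n - 2))"
      using recurrence[of "n - 1"] assms by (simp add: Suc_diff_Suc numeral_2_eq_2)
    ultimately show ?thesis by (simp only: wint_linear mult_smult_left)
  qed
  then have "wint w ([:- ?a, 1:] * (?p * ?p)) = 0"
    using wint_shift_diff[of 0 "?p * ?p" ?a] by (simp add: mult.assoc)
  moreover have "degree ([:- ?a, 1:] * (?p * ?p)) < 2 * n"
    using assms by (simp add: degree_mult_eq del: mult_pCons_left)
  ultimately have "(\<Sum>z\<in>zeros n. christoffel n z * (poly ?p z)\<^sup>2 * (z - ?a)) = 0"
    using gauss_quadrature[of "[:- ?a, 1:] * (?p * ?p)" n]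
    by (simp add: power2_eq_square algebra_simps)
  moreover have "christoffel n z * (poly ?p z)\<^sup>2 > 0" if "z \<in> zeros n" for z
    using christoffel_pos[OF that] zeros_nonzero_pred[of n z] that assms by simp
  ultimately show "\<exists>z\<in>zeros n. z < ?a" "\<exists>z\<in>zeros n. z > ?a"
    using weighted_mean_strictly_between[of "zeros n" "\<lambda>z. christoffel n z * (poly ?p z)\<^sup>2" ?a] assms
    by simp_all
qed

end

text \<open>With \<open>f = (x - a) * q\<^sup>2\<close>, an increasing ratio gives more relative
  mass to the region where \<open>f\<close> is positive. So the integral of \<open>f\<close> stays
  nonnegative and becomes strictly positive under \<open>w2\<close>, while that of
  \<open>(x - b) * q\<^sup>2\<close> under \<open>w2\<close> is at most 0.\<close>

lemma zeros_mono_weight: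
  assumes w1: "pos_weight w1" and w2: "pos_weight w2"
    and w2_eq: "\<And>x. x > 0 \<Longrightarrow> w2 x = \<rho> x * w1 x"
    and \<rho>: "strict_mono_on {0<..} \<rho>"
    and a: "a \<in> pos_weight.zeros w1 n" and b: "b \<in> pos_weight.zeros w2 n"
    and card: "card {z \<in> pos_weight.zeros w1 n. z < a} + card {z \<in> pos_weight.zeros w2 n. b < z} < n"
  shows "a < b"
proof -
  interpret W1: pos_weight w1 by fact
  interpret W2: pos_weight w2 by fact
  define q where "q = node_poly {z \<in> W1.zeros n. z < a} * node_poly {z \<in> W2.zeros n. b < z}"
  have q: "q \<noteq> 0" "degree q < n"
    using card by (simp_all add: q_def degree_mult_eq)
  have va: "poly q z = 0" if "z \<in> W1.zeros n" "1 * (z - a) < 0" for z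
    using that by (simp add: q_def poly_node_poly)
  have vb: "poly q z = 0" if "z \<in> W2.zeros n" "(- 1) * (z - b) < 0" for z
    using that by (simp add: q_def poly_node_poly)
  have a0: "a > 0" using a by (rule W1.zeros_pos)
  have \<rho>_pos: "\<rho> x > 0" if "x > 0" for x
    using w2_eq[OF that] W1.w_pos[OF that] W2.w_pos[OF that] by (simp add: zero_less_mult_iff)
  have A: "1 * wint w1 ([:- a, 1:] * (q * q)) \<ge> 0"
    using q(2) va by (rule W1.wint_shifted_square_nonneg(1))
  have B: "(- 1) * wint w2 ([:- b, 1:] * (q * q)) \<ge> 0"
    using q(2) vb by (rule W2.wint_shifted_square_nonneg(1))
  define f where "f = [:- a, 1:] * (q * q)"
  have f_eq: "poly f x = (x - a) * (poly q x)\<^sup>2" for x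
    by (simp add: f_def power2_eq_square algebra_simps)
  have f0: "f \<noteq> 0" using q(1) by (simp add: f_def del: mult_pCons_left)
  \<comment> \<open>Freezing the ratio at \<open>\<rho> a\<close> works because \<open>x - a\<close>
    and \<open>\<rho> x - \<rho> a\<close> always have the same sign.\<close>
  have "0 < (LBINT x:{0<..}. poly f x * w2 x - \<rho> a * (poly f x * w1 x))"
  proof (rule set_integral_pos)
    show "set_integrable lborel {0<..} (\<lambda>x. poly f x * w2 x - \<rho> a * (poly f x * w1 x))"
      by (intro set_integral_diff set_integrable_mult_right W1.w_int W2.w_int)
    have eq: "poly f x * w2 x - \<rho> a * (poly f x * w1 x) = ((x - a) * (\<rho> x - \<rho> a)) * ((poly q x)\<^sup>2 * w1 x)"
      if "x > 0" for x
      using w2_eq[OF that] by (simp add: f_eq algebra_simps)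
    have mon: "(x - a) * (\<rho> x - \<rho> a) > 0" if "x > 0" "x \<noteq> a" for x
      using strict_mono_onD[OF \<rho>, of x a] strict_mono_onD[OF \<rho>, of a x] that a0
      by (cases "x < a") (auto simp: zero_less_mult_iff)
    show "0 \<le> poly f x * w2 x - \<rho> a * (poly f x * w1 x)" if "x > 0" for x
      unfolding eq[OF that] using mon[OF that] W1.w_pos[OF that]
      by (cases "x = a") (auto intro!: mult_nonneg_nonneg less_imp_le)
    have "{x. x > 0 \<and> poly f x * w2 x - \<rho> a * (poly f x * w1 x) = 0} \<subseteq> {x. poly f x = 0}"
    proof (intro subsetI CollectI)
      fix x assume "x \<in> {x. x > 0 \<and> poly f x * w2 x - \<rho> a * (poly f x * w1 x) = 0}"
      then have x: "x > 0" and "poly f x * w2 x - \<rho> a * (poly f x * w1 x) = 0" by auto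
      then have "((x - a) * (\<rho> x - \<rho> a)) * ((poly q x)\<^sup>2 * w1 x) = 0"
        unfolding eq[OF x] by blast
      moreover have "0 < ((x - a) * (\<rho> x - \<rho> a)) * ((poly q x)\<^sup>2 * w1 x)" if "x \<noteq> a" "poly q x \<noteq> 0"
        using W1.w_pos[OF x] that(2) by (intro mult_pos_pos[OF mon[OF x that(1)]]) simp
      ultimately have "x = a \<or> poly q x = 0" by force
      then show "poly f x = 0" by (auto simp: f_eq)
    qed
    then show "finite {x. x > 0 \<and> poly f x * w2 x - \<rho> a * (poly f x * w1 x) = 0}"
      by (rule finite_subset) (rule poly_roots_finite[OF f0])
  qed
  also have "\<dots> = wint w2 f - \<rho> a * wint w1 f"
    unfolding wint_def
    by (subst set_integral_diff(2)) (auto intro: W1.w_int W2.w_int)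
  finally have "wint w2 f > \<rho> a * wint w1 f" by simp
  moreover have "\<rho> a * wint w1 f \<ge> 0"
    using A \<rho>_pos[OF a0] by (simp add: f_def del: mult_pCons_left)
  ultimately have "wint w2 ([:- a, 1:] * (q * q)) > 0" unfolding f_def by linarith
  then have "(b - a) * wint w2 (q * q) > 0"
    using B W2.wint_shift_diff[of a "q * q" b] by linarith
  moreover have "wint w2 (q * q) > 0" using q by (intro W2.wint_square_pos)
  ultimately show ?thesis by (simp add: zero_less_mult_iff)
qed

section \<open>Chain sequence bounds and the mixed recurrence\<close>

text \<open>The ratios \<open>p (Suc k) / (u k * p k)\<close> dominate the corresponding ratios
  \<open>sin ((k + 2) * \<theta>) / (2 * cos \<theta> * sin ((k + 1) * \<theta>))\<close> of the extremal chain sequence, for which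
  \<open>u k * u (k - 1) = 4 * (cos \<theta>)\<^sup>2 * b k\<close>.\<close>

lemma three_term_pos:
  fixes p u b :: "nat \<Rightarrow> real"
  assumes n: "n \<ge> 2" and p0: "p 0 = 1" and p1: "p 1 = u 0"
    and step: "\<And>k. 1 \<le> k \<Longrightarrow> k < n \<Longrightarrow> p (Suc k) = u k * p k - b k * p (k - 1)"
    and u: "\<And>k. k < n \<Longrightarrow> u k > 0"
    and ub: "\<And>k. 1 \<le> k \<Longrightarrow> k < n \<Longrightarrow> u k * u (k - 1) > 4 * (cos (pi / (real n + 1)))\<^sup>2 * b k"
  shows "p n > 0"
proof -
  define \<theta> where "\<theta> = pi / (real n + 1)"
  define s where "s k = sin (real k * \<theta>)" for k
  define c where "c = 2 * cos \<theta>"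
  have \<theta>: "\<theta> > 0" "\<theta> < pi / 2" "(real n + 1) * \<theta> = pi"
    using n by (simp_all add: \<theta>_def field_simps)
  have c: "c > 0" using cos_gt_zero[OF \<theta>(1,2)] by (simp add: c_def)
  have c2: "4 * (cos \<theta>)\<^sup>2 = c * c" by (simp add: c_def power2_eq_square)
  have s_pos: "s k > 0" if "1 \<le> k" "k \<le> n" for k
  proof -
    have "real k * \<theta> < (real n + 1) * \<theta>" using that \<theta> by (intro mult_strict_right_mono) auto
    then show ?thesis unfolding s_def using that \<theta> by (intro sin_gt_zero) auto
  qed
  \<comment> \<open>The angle is chosen for this value: in the last inequality of the induction the
    lower bound for \<open>p n\<close> becomes 0.\<close>
  have s_end: "s (Suc n) = 0" using \<theta>(3) by (simp add: s_def add.commute)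
  have s_rec: "s (Suc (Suc k)) = c * s (Suc k) - s k" for k
  proof -
    have "real (Suc (Suc k)) * \<theta> = real (Suc k) * \<theta> + \<theta>" "real k * \<theta> = real (Suc k) * \<theta> - \<theta>"
      by (simp_all add: algebra_simps)
    then show ?thesis unfolding s_def c_def by (simp only: sin_add sin_diff) (simp add: algebra_simps)
  qed
  \<comment> \<open>At \<open>k = 0\<close> the two sides are equal, so strictness is available only
    from \<open>k = 1\<close> on; \<open>n \<ge> 2\<close> lets the last index \<open>n - 1\<close>
    profit from it.\<close>
  have main: "p k > 0 \<and> c * s (Suc k) * p (Suc k) \<ge> u k * s (Suc (Suc k)) * p k
      \<and> (k \<ge> 1 \<longrightarrow> c * s (Suc k) * p (Suc k) > u k * s (Suc (Suc k)) * p k)" if "k < n" for k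
    using that
  proof (induction k)
    case 0
    have "s (Suc (Suc 0)) = c * s (Suc 0)" using s_rec[of 0] by (simp add: s_def)
    then show ?case using p0 p1 by simp
  next
    case (Suc k)
    then have IH: "p k > 0" "c * s (Suc k) * p (Suc k) \<ge> u k * s (Suc (Suc k)) * p k"
      by simp_all
    have sp: "s (Suc k) > 0" "s (Suc (Suc k)) > 0" using Suc.prems by (auto intro: s_pos)
    have up: "u k > 0" "u (Suc k) > 0" using u Suc.prems by simp_all
    have "c * s (Suc k) * p (Suc k) > 0"
      using IH sp up by (smt (verit) mult_pos_pos)
    moreover have "c * s (Suc k) > 0" using c sp by simp
    ultimately have pp: "p (Suc k) > 0" by (simp only: zero_less_mult_pos)
    \<comment> \<open>The hypothesis \<open>ub\<close> and the induction hypothesis combine to bound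
      the subtracted term of the recurrence; strictness comes from \<open>ub\<close>.\<close>
    have "c * (c * s (Suc (Suc k)) * (b (Suc k) * p k)) = c * c * b (Suc k) * (s (Suc (Suc k)) * p k)"
      by (simp add: mult_ac)
    also have "\<dots> < u (Suc k) * u k * (s (Suc (Suc k)) * p k)"
      using ub[of "Suc k"] Suc.prems sp IH(1) c2 \<theta>_def by (intro mult_strict_right_mono) auto
    also have "\<dots> = u (Suc k) * (u k * s (Suc (Suc k)) * p k)" by (simp add: mult_ac)
    also have "\<dots> \<le> u (Suc k) * (c * s (Suc k) * p (Suc k))"
      using IH(2) up by (intro mult_left_mono) auto
    also have "\<dots> = c * (u (Suc k) * s (Suc k) * p (Suc k))" by (simp add: mult_ac)
    finally have key: "c * s (Suc (Suc k)) * (b (Suc k) * p k) < u (Suc k) * s (Suc k) * p (Suc k)"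
      using c by simp
    have "p (Suc (Suc k)) = u (Suc k) * p (Suc k) - b (Suc k) * p k"
      using step[of "Suc k"] Suc.prems by simp
    then have "c * s (Suc (Suc k)) * p (Suc (Suc k))
        = c * s (Suc (Suc k)) * u (Suc k) * p (Suc k) - c * s (Suc (Suc k)) * (b (Suc k) * p k)"
      by (simp only:) (simp add: algebra_simps)
    moreover have "u (Suc k) * s (Suc (Suc (Suc k))) * p (Suc k)
        = c * s (Suc (Suc k)) * u (Suc k) * p (Suc k) - u (Suc k) * s (Suc k) * p (Suc k)"
      by (simp only: s_rec[of "Suc k"]) (simp add: algebra_simps)
    ultimately have "c * s (Suc (Suc k)) * p (Suc (Suc k)) > u (Suc k) * s (Suc (Suc (Suc k))) * p (Suc k)"
      using key by linarith
    then show ?case using pp by simp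
  qed
  have "c * s n * p n > 0"
    using main[of "n - 1"] n s_end by simp
  moreover have "c * s n > 0" using c s_pos[of n] n by simp
  ultimately show ?thesis by (simp add: zero_less_mult_iff)
qed

text \<open>The bound is the larger root of \<open>(x - A) * (x - B) = D\<close>, as completing the
  square shows. Positivity of \<open>D\<close> places this root to the right of both
  \<open>A\<close> and \<open>B\<close>.\<close>

lemma right_of_quadratic_root:
  fixes A B D x :: real
  assumes "D > 0" "(A + B) / 2 + sqrt ((A - B)\<^sup>2 + 4 * D) / 2 \<le> x"
  shows "x > A" "x > B" "(x - A) * (x - B) \<ge> D"
    and "(A + B) / 2 + sqrt ((A - B)\<^sup>2 + 4 * D) / 2 < x \<Longrightarrow> (x - A) * (x - B) > D"
proof -
  define s where "s = sqrt ((A - B)\<^sup>2 + 4 * D)"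
  have s2: "s\<^sup>2 = (A - B)\<^sup>2 + 4 * D" using assms(1) by (simp add: s_def)
  have "s > sqrt ((A - B)\<^sup>2)" using assms(1) by (simp only: s_def real_sqrt_less_iff)
  then have s: "s > \<bar>A - B\<bar>" by simp
  have x: "s \<le> 2 * x - A - B" using assms(2) unfolding s_def[symmetric] by (simp add: field_simps)
  show "x > A" "x > B" using s x by linarith+
  have q: "4 * ((x - A) * (x - B)) = (2 * x - A - B)\<^sup>2 - (A - B)\<^sup>2"
    by (simp add: power2_eq_square algebra_simps)
  have "s\<^sup>2 \<le> (2 * x - A - B)\<^sup>2" using x s by (intro power_mono) auto
  then show "(x - A) * (x - B) \<ge> D" using q s2 by linarith
  assume "(A + B) / 2 + sqrt ((A - B)\<^sup>2 + 4 * D) / 2 < x"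
  then have "s < 2 * x - A - B" unfolding s_def[symmetric] by (simp add: field_simps)
  then have "s\<^sup>2 < (2 * x - A - B)\<^sup>2" using s by (intro power_strict_mono) auto
  then show "(x - A) * (x - B) > D" using q s2 by linarith
qed

section \<open>The chain condition excludes zeros\<close>

context pos_weight
begin

text \<open>\<open>three_term_pos\<close> applied to \<open>\<sigma> ^ k * poly (P k) x\<close>. The
  sign \<open>\<sigma> = -1\<close> serves points to the left of all \<alpha> coefficients, where
  the values of \<open>P k\<close> alternate.\<close>

lemma nonzero_of_chain_condition:
  assumes n: "n \<ge> 2" and \<sigma>: "\<sigma> = 1 \<or> \<sigma> = -1"
    and u: "\<And>k. k < n \<Longrightarrow> \<sigma> * (x - rec_alpha P k) > 0"
    and ub: "\<And>k. 1 \<le> k \<Longrightarrow> k < n \<Longrightarrow>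
      (x - rec_alpha P k) * (x - rec_alpha P (k - 1)) > 4 * (cos (pi / (real n + 1)))\<^sup>2 * rec_beta P k"
  shows "poly (P n) x \<noteq> 0"
proof -
  have s2: "\<sigma> * \<sigma> = 1" using \<sigma> by auto
  have "0 < \<sigma> ^ n * poly (P n) x"
  proof (rule three_term_pos[where p = "\<lambda>k. \<sigma> ^ k * poly (P k) x"
        and u = "\<lambda>k. \<sigma> * (x - rec_alpha P k)" and b = "rec_beta P"])
    show "\<sigma> ^ 1 * poly (P 1) x = \<sigma> * (x - rec_alpha P 0)"
      using poly_recurrence[of 0 x] by simp
    fix k assume k1: "1 \<le> k" and "k < n"
    show "\<sigma> ^ Suc k * poly (P (Suc k)) x
        = \<sigma> * (x - rec_alpha P k) * (\<sigma> ^ k * poly (P k) x) - rec_beta P k * (\<sigma> ^ (k - 1) * poly (P (k - 1)) x)"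
    proof -
      obtain m where k: "k = Suc m" using k1 by (cases k) auto
      have e: "\<sigma> ^ Suc k = \<sigma> ^ m" using s2 by (simp add: k mult.assoc[symmetric])
      have "\<sigma> * (x - rec_alpha P k) * (\<sigma> ^ k * poly (P k) x) = \<sigma> ^ Suc k * ((x - rec_alpha P k) * poly (P k) x)"
        by simp
      then have e': "\<sigma> * (x - rec_alpha P k) * (\<sigma> ^ k * poly (P k) x) = \<sigma> ^ m * ((x - rec_alpha P k) * poly (P k) x)"
        by (simp only: e)
      show ?thesis
        unfolding e e' poly_recurrence[of k x] by (simp add: k right_diff_distrib)
    qed
    show "\<sigma> * (x - rec_alpha P k) * (\<sigma> * (x - rec_alpha P (k - 1)))
        > 4 * (cos (pi / (real n + 1)))\<^sup>2 * rec_beta P k"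
    proof -
      have "\<sigma> * (x - rec_alpha P k) * (\<sigma> * (x - rec_alpha P (k - 1)))
          = (\<sigma> * \<sigma>) * ((x - rec_alpha P k) * (x - rec_alpha P (k - 1)))" by (simp only: mult_ac)
      then show ?thesis using ub[OF k1 \<open>k < n\<close>] by (simp only: s2 mult_1_left)
    qed
  qed (use n u in auto)
  then show ?thesis by auto
qed

section \<open>Christoffel's formula and the mixed recurrence\<close>

lemma P_0_nonzero: "poly (P n) 0 \<noteq> 0"
  using P_roots_pos by fastforce

text \<open>The scalar makes the right side vanish at 0, so it is divisible by \<open>x\<close>.
  Integrating the quotient against \<open>x * w\<close> is integrating the right side against
  \<open>w\<close>, which yields the required orthogonality.\<close>

lemma christoffel_formula:
  assumes w': "pos_weight w'" and w'_eq: "\<And>x. x > 0 \<Longrightarrow> w' x = x * w x"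
  shows "[:0, 1:] * monic_OPS w' n = P (Suc n) - smult (poly (P (Suc n)) 0 / poly (P n) 0) (P n)"
proof -
  interpret W': pos_weight w' by fact
  define r where "r = P (Suc n) - smult (poly (P (Suc n)) 0 / poly (P n) 0) (P n)"
  have "poly r 0 = 0" using P_0_nonzero[of n] by (simp add: r_def)
  then obtain q where q: "r = [:0, 1:] * q"
    using poly_eq_0_iff_dvd[of r 0] by (auto simp: dvd_def)
  have lc: "coeff r (Suc n) = 1" by (simp add: r_def coeff_eq_0)
  have "degree r \<le> Suc n" unfolding r_def by (intro degree_diff_le) auto
  then have deg: "degree r = Suc n" using le_degree[of r "Suc n"] lc by simp
  have orth: "orth w' n q"
    unfolding orth_def
  proof (intro conjI allI impI)
    show "coeff q n = 1" using lc by (simp add: q)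
    have "q \<noteq> 0" using deg q by auto
    then show "degree q = n" using deg by (simp add: q)
    fix f :: "real poly" assume f: "degree f < n"
    have "wint w' (q * f) = wint w (r * f)"
      unfolding wint_def using w'_eq
      by (intro set_lebesgue_integral_cong) (auto simp: q mult_ac)
    also have "\<dots> = 0"
      unfolding r_def left_diff_distrib mult_smult_left wint_diff wint_smult using f by (simp add: P_orth)
    finally show "wint w' (q * f) = 0" .
  qed
  show ?thesis unfolding W'.P_eqI[OF orth] q[symmetric] r_def ..
qed

text \<open>For the Laguerre weights \<open>r + s\<close> is \<open>pL_d\<close> and
  \<open>r' * s\<close> is \<open>pL_e\<close>. The point \<open>c\<close> is what remains when all
  values at a zero of \<open>P n\<close> are expressed through \<open>P (n - 1)\<close>.\<close>

lemma mixed_recurrence_point_between_zeros: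
  assumes n: "n \<ge> 2" and w': "pos_weight w'" and w'_eq: "\<And>x. x > 0 \<Longrightarrow> w' x = x * w x"
  defines "Q \<equiv> monic_OPS w'"
  defines "r \<equiv> poly (P n) 0 / poly (P (n - 1)) 0" and "r' \<equiv> poly (P (n - 1)) 0 / poly (P (n - 2)) 0"
    and "s \<equiv> poly (Q (n - 1)) 0 / poly (Q (n - 2)) 0"
  defines "c \<equiv> rec_alpha P (n - 1) + (r + s) * rec_beta P (n - 1) / (r' * s)"
  shows "\<exists>z\<in>zeros n. z < c" "\<exists>z\<in>zeros n. z > c"
proof -
  interpret W': pos_weight w' by fact
  obtain m where m: "n = Suc (Suc m)" using n by (cases n; cases "n - 1") auto
  define \<beta> where "\<beta> = rec_beta P (n - 1)"
  have \<beta>: "\<beta> > 0" using rec_beta_pos[of "n - 1"] n by (simp add: \<beta>_def)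
  have rs: "r' \<noteq> 0" "s \<noteq> 0"
    using P_0_nonzero W'.P_0_nonzero by (simp_all add: r'_def s_def Q_def)
  \<comment> \<open>A second Christoffel step: \<open>s\<close> makes \<open>g\<close> vanish at 0,
    so that dividing by \<open>x\<close> leaves a polynomial \<open>R\<close> of degree at most
    \<open>n - 2\<close>.\<close>
  define g where "g = Q (n - 1) - smult s (Q (n - 2))"
  have "poly g 0 = 0" using W'.P_0_nonzero[of "n - 2"] by (simp add: g_def s_def Q_def)
  then obtain R where R: "g = [:0, 1:] * R"
    using poly_eq_0_iff_dvd[of g 0] by (auto simp: dvd_def)
  have "degree g \<le> Suc m" unfolding g_def Q_def by (intro degree_diff_le) (auto simp: m)
  then have dR: "degree R < n - 1" by (cases "R = 0") (auto simp: R m)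
  have Qn: "x * poly (Q (n - 1)) x = poly (P n) x - r * poly (P (n - 1)) x"
    and Qm: "x * poly (Q (n - 2)) x = poly (P (n - 1)) x - r' * poly (P (n - 2)) x" for x
    using arg_cong[OF christoffel_formula[OF w' w'_eq, of "n - 1"], of "\<lambda>p. poly p x"]
      arg_cong[OF christoffel_formula[OF w' w'_eq, of "n - 2"], of "\<lambda>p. poly p x"]
    by (simp_all add: m Q_def r_def r'_def)
  \<comment> \<open>At a zero of \<open>P n\<close> the recurrence expresses
    \<open>P (n - 2)\<close> through \<open>P (n - 1)\<close>; substituting into both Christoffel
    formulas leaves one linear factor in \<open>z\<close>, with root \<open>c\<close>.\<close>
  have key: "poly R z = r' * s / \<beta> * ((z - c) * poly (P (n - 1)) z / z\<^sup>2)" if z: "z \<in> zeros n" for z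
  proof -
    have z0: "z > 0" using z by (rule zeros_pos)
    have "z * poly R z = poly (Q (n - 1)) z - s * poly (Q (n - 2)) z"
      using arg_cong[OF R, of "\<lambda>p. poly p z"] by (simp add: g_def)
    then have "z * (z * poly R z) = z * poly (Q (n - 1)) z - s * (z * poly (Q (n - 2)) z)"
      by (simp only: right_diff_distrib mult_ac)
    also have "\<dots> = - r * poly (P (n - 1)) z - s * (poly (P (n - 1)) z - r' * poly (P (n - 2)) z)"
      unfolding Qn Qm using z by simp
    also have "poly (P (n - 2)) z = (z - rec_alpha P (n - 1)) * poly (P (n - 1)) z / \<beta>"
      using poly_recurrence[of "n - 1" z] z \<beta> by (simp add: m \<beta>_def field_simps)
    also have "- r * poly (P (n - 1)) z - s * (poly (P (n - 1)) z - r' * ((z - rec_alpha P (n - 1)) * poly (P (n - 1)) z / \<beta>))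
        = r' * s / \<beta> * ((z - c) * poly (P (n - 1)) z)"
      unfolding c_def \<beta>_def[symmetric] using rs \<beta> by (simp add: field_simps)
    finally have "z\<^sup>2 * poly R z = r' * s / \<beta> * ((z - c) * poly (P (n - 1)) z)"
      by (simp only: power2_eq_square mult.assoc)
    moreover have "poly R z = z\<^sup>2 * poly R z / z\<^sup>2" using z0 by simp
    ultimately have "poly R z = r' * s / \<beta> * ((z - c) * poly (P (n - 1)) z) / z\<^sup>2" by simp
    then show ?thesis by (simp only: times_divide_eq_right)
  qed
  have "0 = wint w (P (n - 1) * R)" using dR by (simp add: P_orth)
  also have "\<dots> = (\<Sum>z\<in>zeros n. christoffel n z * poly (P (n - 1) * R) z)"
    using dR degree_mult_le[of "P (n - 1)" R] by (intro gauss_quadrature) simp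
  also have "\<dots> = (\<Sum>z\<in>zeros n. r' * s / \<beta> * (christoffel n z * (poly (P (n - 1)) z)\<^sup>2 / z\<^sup>2 * (z - c)))"
    by (intro sum.cong) (simp_all add: key power2_eq_square mult_ac)
  also have "\<dots> = r' * s / \<beta> * (\<Sum>z\<in>zeros n. christoffel n z * (poly (P (n - 1)) z)\<^sup>2 / z\<^sup>2 * (z - c))"
    by (simp add: sum_distrib_left)
  finally have "(\<Sum>z\<in>zeros n. christoffel n z * (poly (P (n - 1)) z)\<^sup>2 / z\<^sup>2 * (z - c)) = 0"
    using rs \<beta> by simp
  moreover have "christoffel n z * (poly (P (n - 1)) z)\<^sup>2 / z\<^sup>2 > 0" if "z \<in> zeros n" for z
    using christoffel_pos[OF that] zeros_nonzero_pred[of n z] zeros_pos[OF that] that n by simp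
  ultimately show "\<exists>z\<in>zeros n. z < c" "\<exists>z\<in>zeros n. z > c"
    using weighted_mean_strictly_between[of "zeros n" "\<lambda>z. christoffel n z * (poly (P (n - 1)) z)\<^sup>2 / z\<^sup>2" c] n
    by simp_all
qed

end

section \<open>The singularly perturbed Laguerre weight\<close>

text \<open>This is the Euler integral for \<open>Gamma (a + 1)\<close>; nonnegativity makes the
  integrability absolute.\<close>

lemma powr_exp_integrable:
  assumes "(a::real) > -1"
  shows "set_integrable lborel {0<..} (\<lambda>x. x powr a * exp (- x))"
proof -
  have "((\<lambda>x. x powr (a + 1 - 1) / exp x) has_integral Gamma (a + 1)) {0..}"
    using assms by (intro Gamma_integral_real) simp
  then have "(\<lambda>x. x powr a * exp (- x)) integrable_on {0..}"
    by (auto simp: exp_minus field_simps has_integral_integrable)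
  then have "(\<lambda>x. x powr a * exp (- x)) absolutely_integrable_on {0..}"
    by (intro nonnegative_absolutely_integrable_1) auto
  then have "set_integrable lebesgue {0<..} (\<lambda>x. x powr a * exp (- x))"
    by (rule set_integrable_subset) auto
  then show ?thesis
    by (simp add: set_integrable_def integrable_completion)
qed

text \<open>Since \<open>t \<ge> 0\<close>, the perturbing factor \<open>exp (- t / x)\<close> is at
  most 1, and the unperturbed Laguerre integrand dominates.\<close>

lemma pL_weight_monomial_integrable:
  assumes "\<alpha> > -1" "t \<ge> 0"
  shows "set_integrable lborel {0<..} (\<lambda>x. x ^ k * pL_weight t \<alpha> x)"
proof (rule set_integrable_bound)
  show "set_integrable lborel {0<..} (\<lambda>x. x powr (real k + \<alpha>) * exp (- x))"
    using assms by (intro powr_exp_integrable) simp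
  show "set_borel_measurable lborel {0<..} (\<lambda>x. x ^ k * pL_weight t \<alpha> x)"
    unfolding set_borel_measurable_def pL_weight_def by measurable
  have "norm (x ^ k * pL_weight t \<alpha> x) \<le> norm (x powr (real k + \<alpha>) * exp (- x))" if "x > 0" for x
  proof -
    have "x ^ k * pL_weight t \<alpha> x = x powr (real k + \<alpha>) * exp (- x - t / x)"
      using that by (simp add: pL_weight_def powr_add powr_realpow)
    moreover have "exp (- x - t / x) \<le> exp (- x)" using that assms by simp
    ultimately show ?thesis by (simp add: mult_left_mono)
  qed
  then show "AE x in lborel. x \<in> {0<..} \<longrightarrow> norm (x ^ k * pL_weight t \<alpha> x) \<le> norm (x powr (real k + \<alpha>) * exp (- x))"
    by simp
qed

lemma pos_weight_pL:
  assumes "\<alpha> > -1" "t \<ge> 0"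
  shows "pos_weight (pL_weight t \<alpha>)"
proof
  show "pL_weight t \<alpha> x > 0" if "x > 0" for x
    using that by (simp add: pL_weight_def)
  fix p :: "real poly"
  have "set_integrable lborel {0<..} (\<lambda>x. \<Sum>i\<le>degree p. coeff p i * (x ^ i * pL_weight t \<alpha> x))"
    unfolding set_integrable_def scaleR_sum_right
    by (intro Bochner_Integration.integrable_sum, fold set_integrable_def)
       (intro set_integrable_mult_right pL_weight_monomial_integrable assms)
  then show "set_integrable lborel {0<..} (\<lambda>x. poly p x * pL_weight t \<alpha> x)"
    by (simp add: poly_altdef sum_distrib_right mult.assoc)
qed

section \<open>Zeros in increasing order: interlacing and outer bounds\<close>

context pos_weight
begin

definition nth_zero :: "nat \<Rightarrow> nat \<Rightarrow> real" where
  "nth_zero j n = sorted_list_of_set (zeros n) ! (j - 1)"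

lemma nth_zero:
  assumes "1 \<le> j" "j \<le> n"
  shows nth_zero_in_zeros: "nth_zero j n \<in> zeros n"
    and card_less_nth_zero: "card {z \<in> zeros n. z < nth_zero j n} = j - 1"
    and card_greater_nth_zero: "card {z \<in> zeros n. nth_zero j n < z} = n - j"
  using sorted_list_of_set_nth[of "zeros n" "j - 1"] assms unfolding nth_zero_def by simp_all

lemma first_zero_le:
  assumes "z \<in> zeros n"
  shows "nth_zero 1 n \<le> z"
proof -
  have "n \<noteq> 0" using assms by (intro notI) (simp add: zeros_def)
  then have "{z \<in> zeros n. z < nth_zero 1 n} = {}"
    using card_less_nth_zero[of 1 n] by simp
  then show ?thesis using assms by force
qed

lemma last_zero_ge:
  assumes "z \<in> zeros n"
  shows "z \<le> nth_zero n n"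
proof -
  have "n \<noteq> 0" using assms by (intro notI) (simp add: zeros_def)
  then have "{z \<in> zeros n. nth_zero n n < z} = {}"
    using card_greater_nth_zero[of n n] by simp
  then show ?thesis using assms by force
qed

text \<open>In both comparisons the zeros below the first point and those above the second number
  \<open>n - 2\<close> in total, which is less than either degree.\<close>

lemma interlacing:
  assumes "1 \<le> j" "j \<le> n - 1"
  shows "nth_zero j n < nth_zero j (n - 1)" "nth_zero j (n - 1) < nth_zero (j + 1) n"
proof -
  show "nth_zero j n < nth_zero j (n - 1)"
    using assms by (intro zeros_separated[where n = n and m = "n - 1" and k = "n - 2"])
      (simp_all add: nth_zero)
  show "nth_zero j (n - 1) < nth_zero (j + 1) n"
    using assms by (intro zeros_separated[where n = "n - 1" and m = n and k = "n - 2"])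
      (simp_all add: nth_zero)
qed

text \<open>\<open>l k\<close> and \<open>u k\<close> are the roots of
  \<open>(x - A) * (x - B) = c * rec_beta P k\<close> for consecutive \<alpha> coefficients
  \<open>A\<close> and \<open>B\<close>. A zero beyond all of them on one side would satisfy the
  chain condition.\<close>

lemma zero_chain_bounds:
  fixes c :: real
  assumes n: "n \<ge> 2" and z: "z \<in> zeros n" and c: "c \<ge> 4 * (cos (pi / (real n + 1)))\<^sup>2"
  defines "l \<equiv> \<lambda>k. (rec_alpha P k + rec_alpha P (k - 1)) / 2
      - sqrt ((rec_alpha P k - rec_alpha P (k - 1))\<^sup>2 + 4 * c * rec_beta P k) / 2"
    and "u \<equiv> \<lambda>k. (rec_alpha P k + rec_alpha P (k - 1)) / 2
      + sqrt ((rec_alpha P k - rec_alpha P (k - 1))\<^sup>2 + 4 * c * rec_beta P k) / 2"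
  shows "\<exists>k\<in>{1..n - 1}. l k \<le> z" "\<exists>k\<in>{1..n - 1}. z \<le> u k"
    and "c > 4 * (cos (pi / (real n + 1)))\<^sup>2 \<Longrightarrow> \<exists>k\<in>{1..n - 1}. l k < z"
    and "c > 4 * (cos (pi / (real n + 1)))\<^sup>2 \<Longrightarrow> \<exists>k\<in>{1..n - 1}. z < u k"
proof -
  let ?c0 = "4 * (cos (pi / (real n + 1)))\<^sup>2"
  have "cos (pi / (real n + 1)) > 0"
    using n by (intro cos_gt_zero) (auto simp: field_simps)
  then have "?c0 > 0" by simp
  then have cpos: "c > 0" using c by linarith
  \<comment> \<open>The value \<open>\<sigma> = -1\<close> reflects the line and turns lower bounds
    into upper ones. The chain condition is strict, which is ensured either by \<open>c\<close>
    exceeding \<open>?c0\<close> or by \<open>z\<close> lying strictly beyond every bound.\<close>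
  have no: False if \<sigma>: "\<sigma> = 1 \<or> \<sigma> = -1"
    and out: "\<And>k. 1 \<le> k \<Longrightarrow> k < n \<Longrightarrow>
      (\<sigma> * rec_alpha P k + \<sigma> * rec_alpha P (k - 1)) / 2
      + sqrt ((\<sigma> * rec_alpha P k - \<sigma> * rec_alpha P (k - 1))\<^sup>2 + 4 * (c * rec_beta P k)) / 2 \<le> \<sigma> * z"
    and strict: "c > ?c0 \<or> (\<forall>k. 1 \<le> k \<and> k < n \<longrightarrow>
      (\<sigma> * rec_alpha P k + \<sigma> * rec_alpha P (k - 1)) / 2
      + sqrt ((\<sigma> * rec_alpha P k - \<sigma> * rec_alpha P (k - 1))\<^sup>2 + 4 * (c * rec_beta P k)) / 2 < \<sigma> * z)" for \<sigma>
  proof -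
    have *: "\<sigma> * z > \<sigma> * rec_alpha P k" "\<sigma> * z > \<sigma> * rec_alpha P (k - 1)"
      "(z - rec_alpha P k) * (z - rec_alpha P (k - 1)) > ?c0 * rec_beta P k" if k: "1 \<le> k" "k < n" for k
    proof -
      have b: "rec_beta P k > 0" using rec_beta_pos k by simp
      then have D: "c * rec_beta P k > 0" using cpos by simp
      note q = right_of_quadratic_root[OF D out[OF k]]
      show "\<sigma> * z > \<sigma> * rec_alpha P k" "\<sigma> * z > \<sigma> * rec_alpha P (k - 1)" by (fact q)+
      have e: "(\<sigma> * z - \<sigma> * rec_alpha P k) * (\<sigma> * z - \<sigma> * rec_alpha P (k - 1))
          = (z - rec_alpha P k) * (z - rec_alpha P (k - 1))"
        using \<sigma> by (elim disjE) (simp_all add: algebra_simps)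
      from strict show "(z - rec_alpha P k) * (z - rec_alpha P (k - 1)) > ?c0 * rec_beta P k"
      proof
        assume "c > ?c0"
        then have "c * rec_beta P k > ?c0 * rec_beta P k" using b by (rule mult_strict_right_mono)
        then show ?thesis using q(3) unfolding e by linarith
      next
        assume s: "\<forall>k. 1 \<le> k \<and> k < n \<longrightarrow>
          (\<sigma> * rec_alpha P k + \<sigma> * rec_alpha P (k - 1)) / 2
          + sqrt ((\<sigma> * rec_alpha P k - \<sigma> * rec_alpha P (k - 1))\<^sup>2 + 4 * (c * rec_beta P k)) / 2 < \<sigma> * z"
        have "c * rec_beta P k \<ge> ?c0 * rec_beta P k" using c b by (intro mult_right_mono) auto
        then show ?thesis using q(4)[OF s[rule_format, OF conjI[OF k]]] unfolding e by linarith
      qed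
    qed
    have "poly (P n) z \<noteq> 0"
    proof (rule nonzero_of_chain_condition[OF n \<sigma>])
      \<comment> \<open>\<open>rec_alpha P 0\<close> occurs only as the second member of the pair
        with index 1.\<close>
      show "\<sigma> * (z - rec_alpha P k) > 0" if "k < n" for k
        using *(1)[of k] *(2)[of 1] that n by (cases "k = 0") (auto simp: right_diff_distrib)
    qed (fact *(3))
    then show False using z by simp
  qed
  have sq: "(- rec_alpha P k - - rec_alpha P (k - 1))\<^sup>2 = (rec_alpha P k - rec_alpha P (k - 1))\<^sup>2" for k
    by (simp add: power2_eq_square algebra_simps)
  have u_eq: "(1 * rec_alpha P k + 1 * rec_alpha P (k - 1)) / 2
      + sqrt ((1 * rec_alpha P k - 1 * rec_alpha P (k - 1))\<^sup>2 + 4 * (c * rec_beta P k)) / 2 = u k" for k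
    by (simp add: u_def mult.assoc)
  have l_eq: "((- 1) * rec_alpha P k + (- 1) * rec_alpha P (k - 1)) / 2
      + sqrt (((- 1) * rec_alpha P k - (- 1) * rec_alpha P (k - 1))\<^sup>2 + 4 * (c * rec_beta P k)) / 2 = - l k" for k
    unfolding mult_minus1 sq l_def mult.assoc by (simp add: field_simps)
  note upper = no[of 1, unfolded u_eq] and lower = no[of "- 1", unfolded l_eq]
  show "\<exists>k\<in>{1..n - 1}. z \<le> u k"
  proof (rule ccontr)
    assume "\<not> ?thesis"
    then have "u k < z" if "1 \<le> k" "k < n" for k using that by force
    then show False by (intro upper) (auto intro: less_imp_le)
  qed
  show "\<exists>k\<in>{1..n - 1}. l k \<le> z"
  proof (rule ccontr)
    assume "\<not> ?thesis"
    then have "z < l k" if "1 \<le> k" "k < n" for k using that by force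
    then show False by (intro lower) (auto intro: less_imp_le)
  qed
  assume cs: "c > ?c0"
  show "\<exists>k\<in>{1..n - 1}. z < u k"
  proof (rule ccontr)
    assume "\<not> ?thesis"
    then have "u k \<le> z" if "1 \<le> k" "k < n" for k using that by force
    then show False using upper cs by simp
  qed
  show "\<exists>k\<in>{1..n - 1}. l k < z"
  proof (rule ccontr)
    assume "\<not> ?thesis"
    then have "z \<le> l k" if "1 \<le> k" "k < n" for k using that by force
    then show False using lower cs by simp
  qed
qed

end

text \<open>There are \<open>j - 1\<close> zeros below the first point and \<open>n - j\<close>
  above the second, together \<open>n - 1\<close>, as the comparison of weights demands.\<close>

lemma nth_zero_mono_weight:
  assumes w1: "pos_weight w1" and w2: "pos_weight w2"
    and "\<And>x. x > 0 \<Longrightarrow> w2 x = \<rho> x * w1 x" and "strict_mono_on {0<..} \<rho>"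
    and "1 \<le> j" "j \<le> n"
  shows "pos_weight.nth_zero w1 j n < pos_weight.nth_zero w2 j n"
proof -
  interpret W1: pos_weight w1 by fact
  interpret W2: pos_weight w2 by fact
  show ?thesis
  proof (rule zeros_mono_weight[OF assms(1-4)])
    show "W1.nth_zero j n \<in> W1.zeros n" "W2.nth_zero j n \<in> W2.zeros n"
      using assms(5,6) by (rule W1.nth_zero_in_zeros, rule W2.nth_zero_in_zeros)
    show "card {z \<in> W1.zeros n. z < W1.nth_zero j n} + card {z \<in> W2.zeros n. W2.nth_zero j n < z} < n"
      unfolding W1.card_less_nth_zero[OF assms(5,6)] W2.card_greater_nth_zero[OF assms(5,6)]
      using assms(5,6) by linarith
  qed
qed

section \<open>Monotonicity of the zeros in the two parameters\<close>

lemma pL_zero_eq: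
  assumes "\<alpha> > -1" "t \<ge> 0"
  shows "pL_zero j n t \<alpha> = pos_weight.nth_zero (pL_weight t \<alpha>) j n"
  by (simp add: pL_zero_def pL_poly_def pos_weight.nth_zero_def pos_weight.zeros_def pos_weight_pL[OF assms])

text \<open>The ratio is strictly increasing for \<open>d > 0\<close>, and \<open>d = 1\<close>
  gives the factor \<open>x\<close> of Christoffel's formula.\<close>

lemma pL_weight_step_alpha:
  "x > 0 \<Longrightarrow> pL_weight t (\<alpha> + d) x = x powr d * pL_weight t \<alpha> x"
  by (simp add: pL_weight_def powr_add)

lemma pL_weight_step_t:
  "x > 0 \<Longrightarrow> pL_weight (t + d) \<alpha> x = exp (- d / x) * pL_weight t \<alpha> x"
  by (simp add: pL_weight_def exp_add[symmetric] field_simps)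

lemma pL_zero_strict_mono_alpha:
  assumes "t \<ge> 0" "1 \<le> j" "j \<le> n"
  shows "strict_mono_on {-1<..} (\<lambda>\<alpha>. pL_zero j n t \<alpha>)"
proof (rule strict_mono_onI)
  fix r s :: real assume rs: "r \<in> {-1<..}" "s \<in> {-1<..}" "r < s"
  have "strict_mono_on {0<..} (\<lambda>x. x powr (s - r))"
    using rs by (intro strict_mono_onI powr_less_mono2) auto
  then have "pos_weight.nth_zero (pL_weight t r) j n < pos_weight.nth_zero (pL_weight t s) j n"
    using rs assms pL_weight_step_alpha[of _ t r "s - r"]
    by (intro nth_zero_mono_weight pos_weight_pL) auto
  then show "pL_zero j n t r < pL_zero j n t s"
    using rs assms by (simp add: pL_zero_eq)
qed

lemma pL_zero_strict_mono_t:
  assumes "\<alpha> > -1" "1 \<le> j" "j \<le> n"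
  shows "strict_mono_on {0..} (\<lambda>t. pL_zero j n t \<alpha>)"
proof (rule strict_mono_onI)
  fix r s :: real assume rs: "r \<in> {0..}" "s \<in> {0..}" "r < s"
  have "strict_mono_on {0<..} (\<lambda>x. exp (- (s - r) / x))"
  proof (rule strict_mono_onI)
    fix x y :: real assume "x \<in> {0<..}" "y \<in> {0<..}" "x < y"
    then have "(s - r) / y < (s - r) / x" using rs by (intro divide_strict_left_mono) auto
    then show "exp (- (s - r) / x) < exp (- (s - r) / y)" by (simp only: minus_divide_left[symmetric] exp_less_cancel_iff neg_less_iff_less)
  qed
  then have "pos_weight.nth_zero (pL_weight r \<alpha>) j n < pos_weight.nth_zero (pL_weight s \<alpha>) j n"
    using rs assms pL_weight_step_t[of _ r "s - r" \<alpha>]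
    by (intro nth_zero_mono_weight pos_weight_pL) auto
  then show "pL_zero j n r \<alpha> < pL_zero j n s \<alpha>"
    using rs assms by (simp add: pL_zero_eq)
qed

theorem theorem3p2:
  fixes \<alpha> t :: real and n :: nat
  assumes "\<alpha> > -1" and "t \<ge> 0"
  shows
    "((\<forall>z::complex. poly (map_poly complex_of_real (pL_poly n t \<alpha>)) z = 0 \<longrightarrow> z \<in> \<real>)
       \<and> card {x::real. poly (pL_poly n t \<alpha>) x = 0} = n
       \<and> (n \<ge> 2 \<longrightarrow>
            0 < pL_zero 1 n t \<alpha>
            \<and> (\<forall>j\<in>{1..n - 1}. pL_zero j n t \<alpha> < pL_zero j (n - 1) t \<alpha>
                              \<and> pL_zero j (n - 1) t \<alpha> < pL_zero (j + 1) n t \<alpha>)))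
     \<and> (\<forall>j\<in>{1..n}. strict_mono_on {-1<..} (\<lambda>\<alpha>'. pL_zero j n t \<alpha>')
                   \<and> strict_mono_on {0..} (\<lambda>t'. pL_zero j n t' \<alpha>))
     \<and> (n \<ge> 2 \<longrightarrow>
          (\<forall>\<epsilon>\<ge>0. pL_a n \<epsilon> t \<alpha> \<le> pL_zero 1 n t \<alpha>
                  \<and> pL_zero 1 n t \<alpha> < pL_alpha (n - 1) t \<alpha>
                  \<and> pL_alpha (n - 1) t \<alpha> < pL_zero n n t \<alpha>
                  \<and> pL_zero n n t \<alpha> \<le> pL_b n \<epsilon> t \<alpha>)
          \<and> (\<forall>\<epsilon>>0. pL_a n \<epsilon> t \<alpha> < pL_zero 1 n t \<alpha>
                  \<and> pL_zero n n t \<alpha> < pL_b n \<epsilon> t \<alpha>))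
     \<and> (n \<ge> 2 \<longrightarrow>
          0 < pL_zero 1 n t \<alpha>
          \<and> pL_zero 1 n t \<alpha> < pL_alpha (n - 1) t \<alpha> + pL_d n t \<alpha> * pL_beta (n - 1) t \<alpha> / pL_e n t \<alpha>
          \<and> pL_alpha (n - 1) t \<alpha> + pL_d n t \<alpha> * pL_beta (n - 1) t \<alpha> / pL_e n t \<alpha> < pL_zero n n t \<alpha>)"
proof -
  interpret W: pos_weight "pL_weight t \<alpha>"
    using assms by (rule pos_weight_pL)
  have w': "pos_weight (pL_weight t (\<alpha> + 1))"
    using assms by (intro pos_weight_pL) auto
  have w'_eq: "pL_weight t (\<alpha> + 1) x = x * pL_weight t \<alpha> x" if "x > 0" for x
    using pL_weight_step_alpha[OF that, of t \<alpha> 1] that by simp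
  have P: "pL_poly k t \<alpha> = W.P k" for k by (simp add: pL_poly_def)
  have al: "pL_alpha k t \<alpha> = rec_alpha W.P k" and be: "pL_beta k t \<alpha> = rec_beta W.P k" for k
    by (simp_all add: pL_alpha_def pL_beta_def P)
  have zero: "pL_zero j k t \<alpha> = W.nth_zero j k" for j k
    using assms by (rule pL_zero_eq)
  have i: "(\<forall>z::complex. poly (map_poly complex_of_real (pL_poly n t \<alpha>)) z = 0 \<longrightarrow> z \<in> \<real>)
       \<and> card {x::real. poly (pL_poly n t \<alpha>) x = 0} = n"
    using W.P_complex_roots_real W.card_zeros unfolding P W.zeros_def by blast
  have pos: "0 < pL_zero 1 n t \<alpha>" if "n \<ge> 2"
    unfolding zero using that by (intro W.zeros_pos[OF W.nth_zero_in_zeros]) auto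
  have inter: "pL_zero j n t \<alpha> < pL_zero j (n - 1) t \<alpha> \<and> pL_zero j (n - 1) t \<alpha> < pL_zero (j + 1) n t \<alpha>"
    if "j \<in> {1..n - 1}" for j
    unfolding zero using W.interlacing[of j n] that by simp
  have mono: "strict_mono_on {-1<..} (\<lambda>\<alpha>'. pL_zero j n t \<alpha>') \<and> strict_mono_on {0..} (\<lambda>t'. pL_zero j n t' \<alpha>)"
    if "j \<in> {1..n}" for j
    using that assms pL_zero_strict_mono_alpha pL_zero_strict_mono_t by simp
  have between: "pL_zero 1 n t \<alpha> < c \<and> c < pL_zero n n t \<alpha>"
    if "\<exists>z\<in>W.zeros n. z < c" "\<exists>z\<in>W.zeros n. z > c" for c
    unfolding zero using that W.first_zero_le W.last_zero_ge by (meson le_less_trans less_le_trans)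
  \<comment> \<open>Strictness requires \<open>\<epsilon> > 0\<close>: for \<open>n = 2\<close> and
    \<open>\<epsilon> = 0\<close> the constant \<open>pL_c\<close> is 1, and the bounds are exactly
    the two zeros of \<open>P 2\<close>.\<close>
  have bounds: "pL_a n \<epsilon> t \<alpha> \<le> pL_zero 1 n t \<alpha> \<and> pL_zero n n t \<alpha> \<le> pL_b n \<epsilon> t \<alpha>
      \<and> (\<epsilon> > 0 \<longrightarrow> pL_a n \<epsilon> t \<alpha> < pL_zero 1 n t \<alpha> \<and> pL_zero n n t \<alpha> < pL_b n \<epsilon> t \<alpha>)"
    if n: "n \<ge> 2" and \<epsilon>: "\<epsilon> \<ge> 0" for \<epsilon>
  proof -
    have c: "pL_c n \<epsilon> \<ge> 4 * (cos (pi / (real n + 1)))\<^sup>2"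
      "\<epsilon> > 0 \<Longrightarrow> pL_c n \<epsilon> > 4 * (cos (pi / (real n + 1)))\<^sup>2"
      using \<epsilon> by (simp_all add: pL_c_def)
    have ne: "{1..n - 1} \<noteq> {}" using n by simp
    have in1: "W.nth_zero 1 n \<in> W.zeros n" "W.nth_zero n n \<in> W.zeros n"
      using n by (auto intro: W.nth_zero_in_zeros)
    note b1 = W.zero_chain_bounds[OF n in1(1) c(1)] and bn = W.zero_chain_bounds[OF n in1(2) c(1)]
    show ?thesis
      unfolding pL_a_def pL_b_def zero al be
      using b1(1) bn(2) b1(3)[OF c(2)] bn(4)[OF c(2)] ne
      by (auto simp: Min_le_iff Max_ge_iff Min_less_iff Max_gr_iff)
  qed
  have alpha: "pL_zero 1 n t \<alpha> < pL_alpha (n - 1) t \<alpha> \<and> pL_alpha (n - 1) t \<alpha> < pL_zero n n t \<alpha>" if "n \<ge> 2"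
    unfolding al by (rule between[OF W.rec_alpha_between_zeros[OF that]])
  have mixed: "pL_zero 1 n t \<alpha> < pL_alpha (n - 1) t \<alpha> + pL_d n t \<alpha> * pL_beta (n - 1) t \<alpha> / pL_e n t \<alpha>
      \<and> pL_alpha (n - 1) t \<alpha> + pL_d n t \<alpha> * pL_beta (n - 1) t \<alpha> / pL_e n t \<alpha> < pL_zero n n t \<alpha>" if "n \<ge> 2"
    unfolding pL_d_def pL_e_def al be pL_poly_def
    by (rule between[OF W.mixed_recurrence_point_between_zeros[OF that w' w'_eq]])
  show ?thesis
    using i pos inter mono bounds alpha mixed by (intro conjI allI ballI impI) (simp_all add: less_imp_le)
qed

end
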